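(* Suppose that $\{\Gamma(t)\}_{0\le t\le T}$ is a $C^{k+1}$-class solution, for $k=0$, $1$, or $2$, of the initial value problem $$V_j(t)=F_j(\Gamma(t),t)\quad(t\in[0,T],\ j=1,\dots,N),\qquad\Gamma(0)=\Gamma^*,$$ with $\Gamma(t)\in\mathcal{O}$ for $0\le t\le T<T_*$, where $\Gamma^*\in\mathcal{O}$ is a given $N$-polygon. Then there exist $\delta^*>0$, $\tau^*>0$, $C>0$ and a non-decreasing function $\omega(a)>0$ with $$\omega(a)=\begin{cases}o(a^k)&\text{if }k=0\text{ or }1,\\ O(a^2)&\text{if }k=2,\end{cases}\qquad\text{as }a\downarrow0,$$ such that, if $d(\Gamma^*,\Gamma^0)\le\delta^*$ and $\tau\le\tau^*$, then $\Gamma^m\in\mathcal{O}$ ($m=1,2,\dots,\bar m$) are inductively determined by the implicit scheme $$\frac{\boldsymbol{h}(\Gamma^{m+1})-\boldsymbol{h}(\Gamma^m)}{\tau_m}=\boldsymbol{F}\Bigl(\frac{\Gamma^m+\Gamma^{m+1}}{2},\,\frac{t_m+t_{m+1}}{2}\Bigr)\qquad(m=0,1,\dots,\bar m-1)$$ starting from the initial polygon $\Gamma^0\in\mathcal{O}$, and $$\max_{0\le m\le\bar m}d(\Gamma(t_m),\Gamma^m)\le\omega(\tau)+C\,d(\Gamma(0),\Gamma^0)$$ holds.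
   Context: $\mathcal{P}$ is the set of all polygonal Jordan curves in $\mathbb{R}^2$. For an $N$-polygon $\Gamma\in\mathcal{P}$, vertices $\boldsymbol{w}_j$ are numbered counterclockwise (indices periodic modulo $N$), $\Gamma_j$ is the open edge between $\boldsymbol{w}_{j-1}$ and $\boldsymbol{w}_j$ with outward unit normal $\boldsymbol{n}_j$; the outer angles at the vertices lie in $(-\pi,\pi)\setminus\{0\}$; the height of $\Gamma_j$ is $h_j:=\boldsymbol{w}_j\cdot\boldsymbol{n}_j=\boldsymbol{w}_{j-1}\cdot\boldsymbol{n}_j$. Polygons are equivalent if they have the same number of edges and, after suitable counterclockwise numbering, the same normals $\boldsymbol{n}_j$ for all $j$. $\mathcal{P}^*$ is a fixed equivalence class of $N$-polygons. The height function is $\boldsymbol{h}(\Gamma)=(h_1(\Gamma),\dots,h_N(\Gamma))\in\mathbb{R}^N$, and $\mathcal{P}^*$ carries the metric $d(\Gamma,\Sigma)=|\boldsymbol{h}(\Gamma)-\boldsymbol{h}(\Sigma)|_\infty$ (maximum norm). The interpolation $(\Gamma+\Sigma)/2$ is the element of $\mathcal{P}^*$ with height vector $(\boldsymbol{h}(\Gamma)+\boldsymbol{h}(\Sigma))/2$. $\mathcal{O}\subset\mathcal{P}^*$ is open, $T_*\in(0,\infty]$, and $\boldsymbol{F}=(F_1,\dots,F_N):\mathcal{O}\times[0,T_* )\to\mathbb{R}^N$ is a given continuous function with the local Lipschitz property: for every compact $\mathcal{K}\subset\mathcal{O}$ and $T\in(0,T_* )$ there is $L(\mathcal{K},T)>0$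 with $|\boldsymbol{F}(\Gamma,t)-\boldsymbol{F}(\Sigma,t)|_\infty\le L(\mathcal{K},T)\,d(\Gamma,\Sigma)$ for $\Gamma,\Sigma\in\mathcal{K}$, $t\in[0,T]$. A polygonal motion $\Gamma(t)$ in $\mathcal{P}^*$ is of $C^{k+1}$-class on $[0,T]$ if $t\mapsto\boldsymbol{h}(\Gamma(t))$ is in $C^{k+1}([0,T];\mathbb{R}^N)$ (equivalently, all vertices are $C^{k+1}$ in $t$), and $V_j(t)=\frac{d}{dt}h_j(\Gamma(t))$ is the outward normal velocity of its $j$-th edge. The discrete times, given a priori and possibly nonuniform, are $0=t_0<t_1<\cdots<t_{\bar m}\le T$, with $\tau_m:=t_{m+1}-t_m$ and $\tau:=\max_{0\le m<\bar m}\tau_m$. *)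

theory Defs
  imports "HOL-Complex_Analysis.Complex_Analysis" "HOL-Library.Landau_Symbols"
begin

text \<open>
  The plane is \<^typ>\<open>complex\<close>, so that the library's winding number and argument are
  available; \<open>\<bullet>\<close> is the Euclidean inner product. An \<open>N\<close>-polygon is given by the list of its
  \<open>N\<close> vertices in counterclockwise order, with indices \<open>0, \<dots>, N - 1\<close> read modulo \<open>N\<close>.
\<close>

definition vertex :: "complex list \<Rightarrow> nat \<Rightarrow> complex" where
  "vertex w j = w ! (j mod length w)"

text \<open>\<open>vertex w (j + length w - 1)\<close> is the vertex with index \<open>j - 1\<close> modulo the length.\<close>

definition edge_vector :: "complex list \<Rightarrow> nat \<Rightarrow> complex" where
  "edge_vector w j = vertex w j - vertex w (j + length w - 1)"

definition edge :: "complex list \<Rightarrow> nat \<Rightarrow> complex set" where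
  "edge w j = open_segment (vertex w (j + length w - 1)) (vertex w j)"

text \<open>The angle in \<open>(-\<pi>, \<pi>]\<close> from the direction of edge \<open>j\<close> to that of edge \<open>j + 1\<close>.\<close>

definition outer_angle :: "complex list \<Rightarrow> nat \<Rightarrow> real" where
  "outer_angle w j = Arg (edge_vector w (j + 1) / edge_vector w j)"

fun polygonal_path :: "complex list \<Rightarrow> real \<Rightarrow> complex" where
  "polygonal_path (a # b # c # xs) = linepath a b +++ polygonal_path (b # c # xs)"
| "polygonal_path [a, b] = linepath a b"
| "polygonal_path [a] = linepath a a"
| "polygonal_path [] = linepath 0 0"

definition boundary_path :: "complex list \<Rightarrow> real \<Rightarrow> complex" where
  "boundary_path w = polygonal_path (w @ [hd w])"

text \<open>Polygonal Jordan curves, with their vertices numbered counterclockwise.\<close>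

definition polygon :: "complex list \<Rightarrow> bool" where
  "polygon w \<longleftrightarrow>
     3 \<le> length w \<and>
     simple_path (boundary_path w) \<and>
     (\<forall>z \<in> inside (path_image (boundary_path w)). winding_number (boundary_path w) z = 1) \<and>
     (\<forall>j < length w. outer_angle w j \<in> {-pi<..<pi} - {0})"

definition outward_unit_normal :: "complex list \<Rightarrow> nat \<Rightarrow> complex \<Rightarrow> bool" where
  "outward_unit_normal w j \<nu> \<longleftrightarrow>
     norm \<nu> = 1 \<and> \<nu> \<bullet> edge_vector w j = 0 \<and>
     (\<forall>x \<in> edge w j. \<forall>\<^sub>F \<epsilon> in at_right 0.
        x + \<epsilon> *\<^sub>R \<nu> \<in> outside (path_image (boundary_path w)))"

text \<open>
  An equivalence class of polygons is determined by its sequence of outward unit normals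
  \<open>\<nu>\<close>. Every member is listed with the numbering for which its \<open>j\<close>-th outward normal is \<open>\<nu> ! j\<close>,
  so that the heights of different members correspond to each other index by index.
\<close>

definition polygon_class :: "complex list \<Rightarrow> complex list set" where
  "polygon_class \<nu> =
     {w. polygon w \<and> length w = length \<nu> \<and> (\<forall>j < length \<nu>. outward_unit_normal w j (\<nu> ! j))}"

text \<open>
  Vectors in \<open>\<real>\<^sup>N\<close> are functions on \<^typ>\<open>nat\<close> of which only the values at \<open>j < N\<close> matter.
\<close>

definition max_norm :: "nat \<Rightarrow> (nat \<Rightarrow> real) \<Rightarrow> real" where
  "max_norm N x = (MAX j\<in>{..<N}. \<bar>x j\<bar>)"

definition height :: "complex list \<Rightarrow> complex list \<Rightarrow> nat \<Rightarrow> real" where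
  "height \<nu> w j = vertex w j \<bullet> \<nu> ! j"

definition polygon_dist :: "complex list \<Rightarrow> complex list \<Rightarrow> complex list \<Rightarrow> real" where
  "polygon_dist \<nu> w v = max_norm (length \<nu>) (\<lambda>j. height \<nu> w j - height \<nu> v j)"

definition polygon_topology :: "complex list \<Rightarrow> complex list topology" where
  "polygon_topology \<nu> = Metric_space.mtopology (polygon_class \<nu>) (polygon_dist \<nu>)"

text \<open>
  \<open>u\<close> is \<open>(w + v) / 2\<close>. This is a relation since the interpolation of two polygons need not exist
  in a class of nonconvex polygons; it is unique by the metric space property shown below.
\<close>

definition is_interpolation ::
  "complex list \<Rightarrow> complex list \<Rightarrow> complex list \<Rightarrow> complex list \<Rightarrow> bool" where
  "is_interpolation \<nu> w v u \<longleftrightarrow>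
     u \<in> polygon_class \<nu> \<and>
     (\<forall>j < length \<nu>. height \<nu> u j = (height \<nu> w j + height \<nu> v j) / 2)"

text \<open>
  One step of the implicit scheme, from \<open>w\<close> at time \<open>s\<close> to \<open>v\<close> at time \<open>s'\<close>. The interpolation has
  to exist and to lie in the domain \<open>\<O>\<close> of \<open>F\<close>.
\<close>

definition scheme_step ::
  "complex list \<Rightarrow> complex list set \<Rightarrow> (complex list \<Rightarrow> real \<Rightarrow> nat \<Rightarrow> real) \<Rightarrow>
   real \<Rightarrow> real \<Rightarrow> complex list \<Rightarrow> complex list \<Rightarrow> bool" where
  "scheme_step \<nu> \<O> F s s' w v \<longleftrightarrow>
     (\<exists>u \<in> \<O>. is_interpolation \<nu> w v u \<and>
        (\<forall>j < length \<nu>. (height \<nu> v j - height \<nu> w j) / (s' - s) = F u ((s + s') / 2) j))"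

text \<open>\<open>f\<close> is of class \<open>C\<^sup>n\<close> on \<open>S\<close>, with one-sided derivatives at the ends of an interval;
  \<open>D i\<close> is the \<open>i\<close>-th derivative.\<close>

definition C_class_on :: "nat \<Rightarrow> (real \<Rightarrow> real) \<Rightarrow> real set \<Rightarrow> bool" where
  "C_class_on n f S \<longleftrightarrow>
     (\<exists>D :: nat \<Rightarrow> real \<Rightarrow> real.
        (\<forall>t\<in>S. D 0 t = f t) \<and>
        (\<forall>i<n. \<forall>t\<in>S. (D i has_real_derivative D (Suc i) t) (at t within S)) \<and>
        continuous_on S (D n))"

text \<open>The distance is a metric: heights and normals determine the vertices.\<close>

lemma parallel_complex:
  fixes n a b :: complex
  assumes "n \<noteq> 0" "n \<bullet> a = 0" "n \<bullet> b = 0" shows "Im (a / b) = 0"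
proof -
  have 1: "Re n * Re a + Im n * Im a = 0" "Re n * Re b + Im n * Im b = 0"
    using assms by (simp_all add: inner_complex_def)
  have "Re n * (Im a * Re b - Re a * Im b) = 0" "Im n * (Im a * Re b - Re a * Im b) = 0"
    using 1 by algebra+
  then have "Im a * Re b - Re a * Im b = 0"
    using assms(1) by (auto simp: complex_eq_iff)
  then show ?thesis by (simp add: Im_divide)
qed

lemma parallel_normals:
  fixes n m a b d :: complex
  assumes "n \<noteq> 0" "m \<noteq> 0" "n \<bullet> a = 0" "m \<bullet> b = 0" "n \<bullet> d = 0" "m \<bullet> d = 0" "d \<noteq> 0"
  shows "Im (b / a) = 0"
proof -
  have 1: "d \<bullet> n = 0" "d \<bullet> m = 0" using assms by (simp_all add: inner_commute)
  have "Im (n / m) = 0" using parallel_complex[OF assms(7) 1] .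
  then obtain r where r: "n = of_real r * m"
    using assms(2) complex_is_Real_iff[of "n/m"] by (metis Reals_cases nonzero_divide_eq_eq)
  have "m \<bullet> a = 0" using assms(1,3) r
    by (metis inner_scaleR_left mult_eq_0_iff of_real_0 scaleR_conv_of_real)
  then show ?thesis using parallel_complex[OF assms(2,4)] by blast
qed

lemma Metric_space_polygon_class:
  assumes "\<nu> \<noteq> []"
  shows "Metric_space (polygon_class \<nu>) (polygon_dist \<nu>)"
proof
  let ?N = "length \<nu>"
  have N: "0 < ?N" using assms by simp
  have le: "polygon_dist \<nu> x y \<le> c \<longleftrightarrow> (\<forall>j<?N. \<bar>height \<nu> x j - height \<nu> y j\<bar> \<le> c)" for x y c
    unfolding polygon_dist_def max_norm_def using N by (subst Max_le_iff) auto
  have ge: "\<bar>height \<nu> x j - height \<nu> y j\<bar> \<le> polygon_dist \<nu> x y" if "j < ?N" for x y j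
    using le[of x y "polygon_dist \<nu> x y"] that by simp
  show nn: "0 \<le> polygon_dist \<nu> x y" for x y
    using ge[of 0 x y] N by linarith
  show "polygon_dist \<nu> x y = polygon_dist \<nu> y x" for x y
    unfolding polygon_dist_def max_norm_def by (simp add: abs_minus_commute)
  show "polygon_dist \<nu> x z \<le> polygon_dist \<nu> x y + polygon_dist \<nu> y z" for x y z
    unfolding le using ge[of _ x y] ge[of _ y z] by (smt (verit))
  show "polygon_dist \<nu> x y = 0 \<longleftrightarrow> x = y"
    if x: "x \<in> polygon_class \<nu>" and y: "y \<in> polygon_class \<nu>" for x y
  proof
    assume "x = y"
    then show "polygon_dist \<nu> x y = 0"
      using le[of x y 0] nn[of x y] by simp
  next
    assume "polygon_dist \<nu> x y = 0"
    then have eq: "height \<nu> x j = height \<nu> y j" if "j < ?N" for j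
      using ge[OF that, of x y] by simp
    have lx: "length x = ?N" and ly: "length y = ?N"
      using x y by (auto simp: polygon_class_def)
    have nrm: "norm (\<nu> ! j) = 1" "\<nu> ! j \<bullet> edge_vector w j = 0"
      if "j < ?N" "w \<in> polygon_class \<nu>" for j w
      using that by (auto simp: polygon_class_def outward_unit_normal_def)
    show "x = y"
    proof (rule nth_equalityI)
      show "length x = length y" using lx ly by simp
      fix j assume "j < length x"
      then have j: "j < ?N" using lx by simp
      define k where "k = Suc j mod ?N"
      have k: "k < ?N" using N by (simp add: k_def)
      have prev: "(k + ?N - 1) mod ?N = j"
      proof (cases "Suc j = ?N")
        case True then show ?thesis by (simp add: k_def)
      next
        case False
        then have "k = Suc j" using j by (simp add: k_def)
        then show ?thesis using j by simp
      qed
      have ev: "edge_vector w (j + 1) = edge_vector w k" and ek: "edge_vector w k = vertex w k - w ! j"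
        if "length w = ?N" for w
      proof -
        show 2: "edge_vector w k = vertex w k - w ! j"
          by (simp only: edge_vector_def vertex_def that prev)
        have "vertex w (j + 1) = vertex w k"
          by (simp add: vertex_def that k_def)
        moreover have "vertex w (j + 1 + ?N - 1) = w ! j"
          using j by (simp add: vertex_def that)
        ultimately show "edge_vector w (j + 1) = edge_vector w k"
          unfolding 2 by (simp only: edge_vector_def that)
      qed
      let ?d = "x ! j - y ! j"
      have v: "vertex w j = w ! j" if "length w = ?N" for w
        using that j by (simp add: vertex_def)
      have 1: "\<nu> ! j \<bullet> ?d = 0"
        using eq[OF j] by (simp add: height_def v lx ly inner_diff_right inner_commute)
      have 2: "\<nu> ! k \<bullet> ?d = 0"
        using eq[OF k] nrm(2)[OF k x] nrm(2)[OF k y]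
        by (simp add: height_def ek lx ly inner_diff_right inner_commute)
      show "x ! j = y ! j"
      proof (rule ccontr)
        assume "x ! j \<noteq> y ! j"
        then have d: "?d \<noteq> 0" by simp
        have "\<nu> ! j \<noteq> 0" "\<nu> ! k \<noteq> 0" using nrm(1)[OF j x] nrm(1)[OF k x] by auto
        from parallel_normals[OF this nrm(2)[OF j x] nrm(2)[OF k x] 1 2 d]
        have "Im (edge_vector x (j + 1) / edge_vector x j) = 0"
          using ev[OF lx] by simp
        then have "edge_vector x (j + 1) / edge_vector x j \<in> \<real>"
          by (simp add: complex_is_Real_iff)
        then have "outer_angle x j = 0 \<or> outer_angle x j = pi"
          unfolding outer_angle_def by (metis Arg_real)
        moreover have "outer_angle x j \<in> {-pi<..<pi} - {0}"
          using x j by (auto simp: polygon_class_def polygon_def)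
        ultimately show False by auto
      qed
    qed
  qed
qed

end

theory Submission
  imports Defs
begin

text \<open>
  A polygon of the class is determined by its heights, so the motion is an ordinary differential
  equation \<open>h' = f(h, t)\<close> for height vectors and the scheme is its implicit midpoint rule, provided
  that every height vector near the solution belongs to a polygon of the class. The geometric half of
  the proof establishes this proviso, the analytic half is the convergence of the midpoint rule.

  Geometry. The height vectors of the class form an open set (\<open>polygon_class_heights_open\<close>). The
  vertices solve a linear system whose right-hand side consists of the heights, so a small change of
  the heights moves the vertices a little, and since the normals are kept, every edge vector is
  multiplied by a positive factor; the outer angles do not change. It remains to see that the moved
  curve is still simple, still winds once around its inside, and still has the given normals pointing
  outward. All three follow at once from a homeomorphism of the plane that carries the old curve to the
  new one: the displacement of the curve is a Lipschitz function of the point on the curve, with a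
  constant proportional to the size of the displacement (\<open>boundary_path_perturbation\<close>). Extended to the
  plane by McShane's formula it becomes a map \<open>g\<close> with constant below \<open>1\<close>, and \<open>id + g\<close> is the
  homeomorphism. By compactness of the time interval there is then a tube around the curve of height
  vectors of the solution whose points are all realised by polygons in one compact subset of
  \<open>\<O>\<close> (\<open>polygonal_motion_tube\<close>). On that tube the right-hand side is bounded and Lipschitz.

  Analysis. While the error is below half the radius of the tube, the midpoint of the next step is the
  fixed point of a contraction of a ball inside the tube; so the step exists and is unique among nearby
  polygons. The Lipschitz bound turns a step of length \<open>\<tau>\<close> into the factor \<open>exp (2 L \<tau>)\<close> for the error,
  plus the consistency error of the step; these factors multiply to at most \<open>exp (2 L T)\<close>, so that the
  error stays in the tube once \<open>\<tau>\<close> and the initial error are small (\<open>implicit_midpoint_convergence\<close>).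
  The consistency error per unit time comes from expanding the heights about the midpoint of the
  step (\<open>midpoint_consistency\<close>): in the difference of the two endpoint values the even powers cancel, so
  that a solution of class \<open>C\<^sup>3\<close> gives \<open>O(\<tau>\<^sup>2)\<close>; for lower regularity the modulus of continuity of the
  highest derivative gives \<open>o(\<tau>\<^sup>k)\<close>.
\<close>

section \<open>Lipschitz perturbations of the identity of the plane\<close>

text \<open>
  McShane's extension. The data are indexed by \<open>I\<close> rather than given as a function on the set of the
  points \<open>p i\<close>: for a closed path the index is the parameter, and that equal points carry equal values
  is then part of the hypothesis.
\<close>

lemma lipschitz_extension_real:
  fixes p :: "'i \<Rightarrow> 'a::metric_space" and q :: "'i \<Rightarrow> real"
  assumes "I \<noteq> {}" and L: "0 \<le> L"
    and pq: "\<And>i j. i \<in> I \<Longrightarrow> j \<in> I \<Longrightarrow> \<bar>q i - q j\<bar> \<le> L * dist (p i) (p j)"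
  obtains g where "L-lipschitz_on UNIV g" "\<And>i. i \<in> I \<Longrightarrow> g (p i) = q i"
proof
  define g where "g x = (INF i\<in>I. q i + L * dist x (p i))" for x
  have bdd: "bdd_below ((\<lambda>i. q i + L * dist x (p i)) ` I)" for x
  proof -
    obtain i0 where i0: "i0 \<in> I" using assms(1) by auto
    have "q i0 - L * dist x (p i0) \<le> q i + L * dist x (p i)" if "i \<in> I" for i
    proof -
      have "\<bar>q i0 - q i\<bar> \<le> L * dist (p i0) (p i)" using pq i0 that by blast
      also have "\<dots> \<le> L * (dist x (p i0) + dist x (p i))"
        by (intro mult_left_mono L) (metis dist_commute dist_triangle)
      finally show ?thesis by (simp add: algebra_simps)
    qed
    then show ?thesis by (auto intro!: bdd_belowI2)
  qed
  have le: "g x \<le> g y + L * dist x y" for x y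
  proof -
    have "g x - L * dist x y \<le> q i + L * dist y (p i)" if "i \<in> I" for i
    proof -
      have "g x \<le> q i + L * dist x (p i)"
        unfolding g_def using bdd that by (intro cINF_lower)
      also have "L * dist x (p i) \<le> L * (dist x y + dist y (p i))"
        by (intro mult_left_mono L dist_triangle)
      finally show ?thesis by (simp add: algebra_simps)
    qed
    then have "g x - L * dist x y \<le> g y"
      unfolding g_def[of y] using assms(1) by (intro cINF_greatest)
    then show ?thesis by simp
  qed
  show "L-lipschitz_on UNIV g"
  proof (rule lipschitz_onI[OF _ L])
    fix x y show "dist (g x) (g y) \<le> L * dist x y"
      using le[of x y] le[of y x] by (simp add: dist_real_def dist_commute abs_le_iff)
  qed
  show "g (p i) = q i" if i: "i \<in> I" for i
  proof (rule antisym)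
    have "g (p i) \<le> q i + L * dist (p i) (p i)"
      unfolding g_def using bdd i by (intro cINF_lower)
    then show "g (p i) \<le> q i" by simp
    have "q i \<le> q k + L * dist (p i) (p k)" if "k \<in> I" for k
      using pq[OF i that] by linarith
    then show "q i \<le> g (p i)"
      unfolding g_def using assms(1) by (intro cINF_greatest)
  qed
qed

text \<open>
  Extending the two components separately costs a factor \<open>2\<close> in the constant, which is harmless here and
  avoids Kirszbraun's theorem.
\<close>

lemma lipschitz_extension_complex:
  fixes p :: "'i \<Rightarrow> 'a::metric_space" and q :: "'i \<Rightarrow> complex"
  assumes "I \<noteq> {}" and L: "0 \<le> L"
    and pq: "\<And>i j. i \<in> I \<Longrightarrow> j \<in> I \<Longrightarrow> norm (q i - q j) \<le> L * dist (p i) (p j)"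
  obtains g where "(2 * L)-lipschitz_on UNIV g" "\<And>i. i \<in> I \<Longrightarrow> g (p i) = q i"
proof -
  have "\<bar>Re (q i) - Re (q j)\<bar> \<le> L * dist (p i) (p j)" "\<bar>Im (q i) - Im (q j)\<bar> \<le> L * dist (p i) (p j)"
    if "i \<in> I" "j \<in> I" for i j
    using pq[OF that] abs_Re_le_cmod[of "q i - q j"] abs_Im_le_cmod[of "q i - q j"] by auto
  then obtain a b where
    a: "L-lipschitz_on UNIV a" "\<And>i. i \<in> I \<Longrightarrow> a (p i) = Re (q i)" and
    b: "L-lipschitz_on UNIV b" "\<And>i. i \<in> I \<Longrightarrow> b (p i) = Im (q i)"
    using lipschitz_extension_real[OF assms(1,2), of "\<lambda>i. Re (q i)" p]
      lipschitz_extension_real[OF assms(1,2), of "\<lambda>i. Im (q i)" p] by metis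
  show thesis
  proof
    show "(2 * L)-lipschitz_on UNIV (\<lambda>x. Complex (a x) (b x))"
    proof (rule lipschitz_onI)
      fix x y
      have "norm (Complex (a x) (b x) - Complex (a y) (b y)) \<le> \<bar>a x - a y\<bar> + \<bar>b x - b y\<bar>"
        by (rule order_trans[OF cmod_le]) simp
      also have "\<dots> \<le> L * dist x y + L * dist x y"
        using lipschitz_onD[OF a(1), of x y] lipschitz_onD[OF b(1), of x y]
        by (simp add: dist_real_def)
      finally show "dist (Complex (a x) (b x)) (Complex (a y) (b y)) \<le> 2 * L * dist x y"
        by (simp add: dist_norm)
    qed (use L in simp)
    show "\<And>i. i \<in> I \<Longrightarrow> Complex (a (p i)) (b (p i)) = q i" using a b by simp
  qed
qed

text \<open>
  The map carries the component of \<open>x\<close> in the complement of \<open>S\<close> into one component of the complement of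
  the image, and an expanding map does not make an unbounded set bounded.
\<close>

lemma expanding_outside:
  fixes \<Phi> :: "'a::real_normed_vector \<Rightarrow> 'a"
  assumes cont: "continuous_on UNIV \<Phi>" and c: "0 < c"
    and exp: "\<And>x y. c * dist x y \<le> dist (\<Phi> x) (\<Phi> y)" and x: "x \<in> outside S"
  shows "\<Phi> x \<in> outside (\<Phi> ` S)"
proof -
  have inj: "\<Phi> x = \<Phi> y \<longleftrightarrow> x = y" for x y
    using exp[of x y] c by (auto simp: mult_le_0_iff)
  define C where "C = connected_component_set (- S) x"
  have xS: "x \<notin> S" and unb: "\<not> bounded C" using x by (auto simp: outside_def C_def)
  have "connected (\<Phi> ` C)" unfolding C_def
    by (intro connected_continuous_image connected_connected_component
        continuous_on_subset[OF cont]) auto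
  moreover have "C \<subseteq> - S" unfolding C_def by (rule connected_component_subset)
  then have "\<Phi> ` C \<subseteq> - (\<Phi> ` S)" using inj by auto
  moreover have "\<Phi> x \<in> \<Phi> ` C" using xS by (auto simp: C_def)
  ultimately have sub: "\<Phi> ` C \<subseteq> connected_component_set (- (\<Phi> ` S)) (\<Phi> x)"
    by (intro connected_component_maximal)
  have "\<not> bounded (\<Phi> ` C)"
  proof
    assume "bounded (\<Phi> ` C)"
    then obtain e where e: "\<And>y. y \<in> C \<Longrightarrow> dist (\<Phi> x) (\<Phi> y) \<le> e"
      by (metis bounded_any_center imageI)
    have "dist x y \<le> e / c" if "y \<in> C" for y
      using e[OF that] exp[of x y] c by (simp add: field_simps)
    then show False using unb by (auto simp: bounded_def)
  qed
  then show ?thesis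
    using xS inj bounded_subset[OF _ sub] by (auto simp: outside_def)
qed

context
  fixes g :: "complex \<Rightarrow> complex" and L :: real
  assumes g: "L-lipschitz_on UNIV g" and L: "L < 1"
begin

lemma perturbed_id_diff: "norm ((x + g x) - (y + g y) - (x - y)) \<le> L * norm (x - y)"
  using lipschitz_onD[OF g, of x y] by (simp add: dist_norm)

lemma perturbed_id_expanding: "(1 - L) * dist x y \<le> dist (x + g x) (y + g y)"
proof -
  have "norm (x - y) - norm ((x + g x) - (y + g y)) \<le> norm ((x + g x) - (y + g y) - (x - y))"
    by (metis norm_minus_commute norm_triangle_ineq2)
  with perturbed_id_diff[of x y] show ?thesis by (simp add: dist_norm algebra_simps)
qed

lemma perturbed_id_inj: "x + g x = y + g y \<longleftrightarrow> x = y"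
  using perturbed_id_expanding[of x y] L by (auto simp: mult_le_0_iff)

text \<open>
  The preimage of \<open>z\<close> is the fixed point of the contraction \<open>x \<mapsto> z - g x\<close>.
\<close>

lemma perturbed_id_surj: "\<exists>x. x + g x = z"
proof -
  have "0 \<le> L" using g by (rule lipschitz_on_nonneg)
  moreover have "dist (z - g x) (z - g y) \<le> L * dist x y" for x y
    using lipschitz_onD[OF g, of x y] by (simp add: dist_norm norm_minus_commute)
  ultimately have "\<exists>!x. z - g x = x"
    using L by (intro banach_fix_type) auto
  then show ?thesis by (metis diff_add_cancel)
qed

lemma perturbed_id_continuous: "continuous_on S (\<lambda>x. x + g x)"
  by (intro continuous_intros continuous_on_subset[OF lipschitz_on_continuous_on[OF g]]) simp

lemma perturbed_id_outside:
  "x \<in> outside S \<Longrightarrow> x + g x \<in> outside ((\<lambda>x. x + g x) ` S)"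
  using expanding_outside[OF perturbed_id_continuous, of "1 - L" x S] perturbed_id_expanding L
  by auto

lemma perturbed_id_inside:
  assumes "z \<in> inside ((\<lambda>x. x + g x) ` S)"
  obtains x where "x \<in> inside S" "z = x + g x"
proof -
  obtain x where x: "z = x + g x" using perturbed_id_surj by metis
  have "x \<notin> S" using assms x by (metis IntI empty_iff imageI inside_no_overlap)
  moreover have "x \<notin> outside S"
    using assms x perturbed_id_outside by (metis IntI empty_iff inside_Int_outside)
  ultimately have "x \<in> inside S" using inside_Un_outside[of S] by blast
  then show thesis using x that by blast
qed

text \<open>
  After translating both loops so that the base point is \<open>0\<close>, they differ at each parameter by less
  than the distance to \<open>0\<close>.
\<close>

lemma perturbed_id_winding_number:
  assumes "path p" "pathfinish p = pathstart p" "z \<notin> path_image p"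
  shows "winding_number (\<lambda>s. p s + g (p s)) (z + g z) = winding_number p z"
proof -
  have "winding_number (\<lambda>s. p s + g (p s) - (z + g z)) 0 = winding_number (\<lambda>s. p s - z) 0"
  proof (rule winding_number_nearby_loops_eq)
    show "path (\<lambda>s. p s - z)"
      using assms(1) unfolding path_def by (intro continuous_intros)
    show "path (\<lambda>s. p s + g (p s) - (z + g z))"
      using assms(1) unfolding path_def
      by (intro continuous_intros continuous_on_compose2[OF lipschitz_on_continuous_on[OF g]]) auto
    show "norm (p t + g (p t) - (z + g z) - (p t - z)) < norm (p t - z - 0)" if "t \<in> {0..1}" for t
    proof -
      have "0 < norm (p t - z)" using assms(3) that by (auto simp: path_image_def)
      then have "L * norm (p t - z) < norm (p t - z)" using L by simp
      then show ?thesis using perturbed_id_diff[of "p t" z] by simp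
    qed
  qed (use assms(2) in \<open>simp_all add: pathfinish_def pathstart_def\<close>)
  then show ?thesis
    using winding_number_offset[of p z] winding_number_offset[of "\<lambda>s. p s + g (p s)" "z + g z"] by simp
qed

end

section \<open>Boundary paths of polygons with displaced vertices\<close>

text \<open>
  The boundary path with \<open>n\<close> sides reaches its \<open>i\<close>-th vertex at the parameter \<open>knot n i\<close>: each \<open>+++\<close> gives
  half of the remaining parameter interval to the next side, and the last side gets all that is left.
\<close>

definition knot :: "nat \<Rightarrow> nat \<Rightarrow> real" where
  "knot n i = (if i < n then 1 - 1 / 2 ^ i else 1)"

lemma knot_0: "0 < n \<Longrightarrow> knot n 0 = 0" and knot_self: "knot n n = 1"
  by (simp_all add: knot_def)

lemma knot_Suc_Suc: "knot (Suc n) (Suc i) = 1 / 2 + knot n i / 2"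
  by (simp add: knot_def diff_divide_distrib)

lemma knot_less: "i < j \<Longrightarrow> j \<le> n \<Longrightarrow> knot n i < knot n j"
  by (auto simp: knot_def divide_strict_left_mono)

lemma knot_le: "i \<le> j \<Longrightarrow> j \<le> n \<Longrightarrow> knot n i \<le> knot n j"
  using knot_less[of i j n] by (cases "i = j") auto

lemma knot_bounds: "i \<le> n \<Longrightarrow> 0 \<le> knot n i \<and> knot n i \<le> 1"
  by (auto simp: knot_def)

lemma pathstart_polygonal_path: "pathstart (polygonal_path (x # xs)) = x"
  by (cases "x # xs" rule: polygonal_path.cases) auto

lemma pathfinish_polygonal_path: "xs \<noteq> [] \<Longrightarrow> pathfinish (polygonal_path xs) = last xs"
  by (induction xs rule: polygonal_path.induct) auto

text \<open>
  The knots do not depend on the vertices, so that the paths of two polygons with equally many vertices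
  traverse corresponding points of corresponding sides at the same time. This is what makes the
  difference of two boundary paths affine on each side.
\<close>

lemma polygonal_path_knot:
  assumes "length ws = Suc n" "i < n" "0 \<le> s" "s \<le> 1"
  shows "polygonal_path ws (knot n i + s * (knot n (Suc i) - knot n i)) =
    linepath (ws ! i) (ws ! Suc i) s"
  using assms
proof (induction ws arbitrary: n i rule: polygonal_path.induct)
  case (1 a b c xs)
  obtain n' where n: "n = Suc n'" "0 < n'" using 1(2) by auto
  show ?case
  proof (cases i)
    case 0
    then have eq: "knot n i + s * (knot n (Suc i) - knot n i) = s / 2"
      using n by (auto simp: knot_def)
    show ?thesis unfolding eq using 0 1(4,5) by (simp add: joinpaths_def)
  next
    case (Suc i')
    define t where "t = knot n' i' + s * (knot n' (Suc i') - knot n' i')"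
    have i': "i' < n'" using Suc n 1(3) by simp
    have eq: "knot n i + s * (knot n (Suc i) - knot n i) = 1 / 2 + t / 2"
      by (simp only: Suc n knot_Suc_Suc t_def) (simp add: field_simps)
    have IH: "polygonal_path (b # c # xs) t = linepath ((b # c # xs) ! i') ((b # c # xs) ! Suc i') s"
      unfolding t_def using 1 n i' by (intro 1(1)) auto
    have t: "0 \<le> t" unfolding t_def
      using knot_bounds[of i' n'] knot_less[of i' "Suc i'" n'] i' 1(4)
      by (intro add_nonneg_nonneg mult_nonneg_nonneg) auto
    have "polygonal_path (a # b # c # xs) (1 / 2 + t / 2) = polygonal_path (b # c # xs) t"
    proof (cases "t = 0")
      case True
      then show ?thesis
        using pathstart_polygonal_path[of b "c # xs"]
        by (simp add: joinpaths_def linepath_def pathstart_def)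
    qed (use t in \<open>simp add: joinpaths_def\<close>)
    then show ?thesis using IH Suc eq by simp
  qed
next
  case (2 a b)
  then have "n = 1" "i = 0" by auto
  then show ?case by (simp add: knot_def)
qed auto

lemma knot_cover:
  assumes "0 < n" "0 \<le> t" "t \<le> 1"
  obtains i s where "i < n" "0 \<le> s" "s \<le> 1" "t = knot n i + s * (knot n (Suc i) - knot n i)"
proof -
  have "\<exists>i<m. knot n i \<le> t \<and> t \<le> knot n (Suc i)" if "0 < m" "t \<le> knot n m" for m
    using that
  proof (induction m)
    case (Suc m)
    show ?case
    proof (cases "0 < m \<and> t \<le> knot n m")
      case True then show ?thesis using Suc less_SucI by blast
    next
      case False
      then have "knot n m \<le> t" using assms(1,2) by (cases "m = 0") (auto simp: knot_0)
      then show ?thesis using Suc by auto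
    qed
  qed auto
  from this[of n] obtain i where i: "i < n" "knot n i \<le> t" "t \<le> knot n (Suc i)"
    using assms by (auto simp: knot_self)
  have "knot n i < knot n (Suc i)" using i by (intro knot_less) auto
  with i show thesis
    by (intro that[of i "(t - knot n i) / (knot n (Suc i) - knot n i)"]) (auto simp: field_simps)
qed

definition side :: "complex list \<Rightarrow> nat \<Rightarrow> real \<Rightarrow> complex" where
  "side w i = linepath (vertex w i) (vertex w (Suc i))"

lemma compact_side: "compact (side w i ` {0..1})"
  unfolding side_def by (intro compact_continuous_image continuous_intros) auto

lemma vertex_mod: "vertex w (i mod length w) = vertex w i"
  by (simp add: vertex_def)

lemma side_mod: "side w (i mod length w) = side w i"
  by (simp add: side_def vertex_def mod_Suc_eq)

lemma edge_vector_mod: "edge_vector w (i mod length w) = edge_vector w i"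
proof (cases "w = []")
  case False
  then have "vertex w (i mod length w + length w - 1) = vertex w (i + length w - 1)"
    unfolding vertex_def
    by (metis Nat.add_diff_assoc One_nat_def Suc_leI length_greater_0_conv mod_add_left_eq)
  then show ?thesis by (simp add: edge_vector_def vertex_mod)
qed simp

lemma edge_vector_Suc: "w \<noteq> [] \<Longrightarrow> edge_vector w (Suc i) = vertex w (Suc i) - vertex w i"
  by (simp add: edge_vector_def vertex_def)

lemma side_alt: "w \<noteq> [] \<Longrightarrow> side w i s = vertex w i + s *\<^sub>R edge_vector w (Suc i)"
  by (simp add: edge_vector_Suc side_def linepath_def algebra_simps)

lemma boundary_path_knot:
  assumes "i < length w" "0 \<le> s" "s \<le> 1"
  shows "boundary_path w (knot (length w) i + s * (knot (length w) (Suc i) - knot (length w) i)) = side w i s"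
proof -
  have "(w @ [hd w]) ! k = vertex w k" if "k \<le> length w" for k
    using that assms(1) hd_conv_nth[of w] gr_implies_not0[OF assms(1)]
    by (cases "k = length w") (auto simp: nth_append vertex_def)
  then show ?thesis
    using polygonal_path_knot[of "w @ [hd w]" "length w" i s] assms
    by (simp add: boundary_path_def side_def)
qed

lemma boundary_path_cover:
  assumes "w \<noteq> []" "t \<in> {0..1}"
  obtains i s where "i < length w" "0 \<le> s" "s \<le> 1"
    "\<And>v. length v = length w \<Longrightarrow> boundary_path v t = side v i s"
proof -
  obtain i s where "i < length w" "0 \<le> s" "s \<le> 1"
    "t = knot (length w) i + s * (knot (length w) (Suc i) - knot (length w) i)"
    using knot_cover[of "length w" t] assms by auto
  then show thesis using that boundary_path_knot by metis
qed

lemma simple_side_params: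
  assumes "simple_path (boundary_path w)" "i < length w" "j < length w"
    and s: "0 \<le> s" "s \<le> 1" "0 \<le> s'" "s' \<le> 1" and eq: "side w i s = side w j s'"
  defines "t \<equiv> knot (length w) i + s * (knot (length w) (Suc i) - knot (length w) i)"
    and "t' \<equiv> knot (length w) j + s' * (knot (length w) (Suc j) - knot (length w) j)"
  shows "t = t' \<or> t = 0 \<and> t' = 1 \<or> t = 1 \<and> t' = 0"
    and "knot (length w) i \<le> t" "t \<le> knot (length w) (Suc i)"
    and "knot (length w) j \<le> t'" "t' \<le> knot (length w) (Suc j)"
    and "0 < s \<Longrightarrow> s < 1 \<Longrightarrow> knot (length w) i < t \<and> t < knot (length w) (Suc i)"
proof -
  have conv: "a \<le> a + r * (b - a) \<and> a + r * (b - a) \<le> b"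
    if "a < b" "0 \<le> r" "r \<le> 1" for a b r :: real
    using that mult_right_mono[of r 1 "b - a"] mult_nonneg_nonneg[of r "b - a"]
    unfolding mult_1 by linarith
  have conv': "a < a + r * (b - a) \<and> a + r * (b - a) < b"
    if "a < b" "0 < r" "r < 1" for a b r :: real
    using that mult_strict_right_mono[of r 1 "b - a"] mult_pos_pos[of r "b - a"]
    unfolding mult_1 by linarith
  have lt: "knot (length w) i < knot (length w) (Suc i)" "knot (length w) j < knot (length w) (Suc j)"
    using assms(2,3) by (auto intro: knot_less)
  show b: "knot (length w) i \<le> t" "t \<le> knot (length w) (Suc i)"
      "knot (length w) j \<le> t'" "t' \<le> knot (length w) (Suc j)"
    unfolding t_def t'_def using conv lt s by blast+
  show "0 < s \<Longrightarrow> s < 1 \<Longrightarrow> knot (length w) i < t \<and> t < knot (length w) (Suc i)"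
    unfolding t_def using conv' lt by blast
  have "t \<in> {0..1}" "t' \<in> {0..1}"
    using b knot_bounds[of i "length w"] knot_bounds[of "Suc i" "length w"]
      knot_bounds[of j "length w"] knot_bounds[of "Suc j" "length w"] assms(2,3) by auto
  moreover have "boundary_path w t = boundary_path w t'"
    unfolding t_def t'_def using boundary_path_knot s assms(2,3) eq by simp
  ultimately show "t = t' \<or> t = 0 \<and> t' = 1 \<or> t = 1 \<and> t' = 0"
    using assms(1) by (auto simp: simple_path_def loop_free_def)
qed

text \<open>
  The parameter intervals of two sides that are not neighbours are separated by a whole interval, and
  the only coincidence allowed between separated parameters is that of \<open>0\<close> and \<open>1\<close>.
\<close>

lemma simple_sides_meet:
  assumes "simple_path (boundary_path w)" "i < j" "j < length w"
    and "0 \<le> s" "s \<le> 1" "0 \<le> s'" "s' \<le> 1" "side w i s = side w j s'"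
  shows "j = Suc i \<or> i = 0 \<and> Suc j = length w"
proof (rule ccontr)
  assume neg: "\<not> ?thesis"
  have i: "i < length w" using assms by simp
  note P = simple_side_params[OF assms(1) i assms(3-8)]
  have "knot (length w) (Suc i) < knot (length w) j"
    using neg assms(2,3) by (intro knot_less) auto
  moreover have "0 < knot (length w) i \<or> knot (length w) (Suc j) < 1"
    using neg knot_less[of 0 i "length w"] knot_0[of "length w"] i
      knot_less[of "Suc j" "length w" "length w"] knot_self[of "length w"] assms(3)
    by force
  ultimately show False using P(1-5) by linarith
qed

lemma simple_side_interior:
  assumes "simple_path (boundary_path w)" "i < length w" "j < length w"
    and "0 < s" "s < 1" "0 \<le> s'" "s' \<le> 1" and eq: "side w i s = side w j s'"
  shows "i = j"
proof (rule ccontr)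
  assume "i \<noteq> j"
  have s: "0 \<le> s" "s \<le> 1" using assms by auto
  note P = simple_side_params[OF assms(1-3) s assms(6,7) eq]
  have *: "knot (length w) (Suc i) \<le> knot (length w) j \<or> knot (length w) (Suc j) \<le> knot (length w) i"
    using \<open>i \<noteq> j\<close> assms(2,3) knot_le[of "Suc i" j "length w"] knot_le[of "Suc j" i "length w"]
    by (cases "i < j") auto
  have "0 \<le> knot (length w) i" "knot (length w) (Suc i) \<le> 1"
    using knot_bounds[of i "length w"] knot_bounds[of "Suc i" "length w"] assms by auto
  then show False using P(1,4,5) P(6)[OF assms(4,5)] * by linarith
qed

lemma polygon_length: "polygon w \<Longrightarrow> 3 \<le> length w" "polygon w \<Longrightarrow> w \<noteq> []"
  by (auto simp: polygon_def)

lemma polygon_edges_not_parallel: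
  assumes "polygon w"
  shows "Im (edge_vector w (Suc j) / edge_vector w j) \<noteq> 0"
proof
  let ?i = "j mod length w"
  assume 0: "Im (edge_vector w (Suc j) / edge_vector w j) = 0"
  have e: "edge_vector w (?i + 1) = edge_vector w (Suc j)"
    using edge_vector_mod[of w "Suc ?i"] edge_vector_mod[of w "Suc j"] by (simp add: mod_Suc_eq)
  have "outer_angle w ?i = 0 \<or> outer_angle w ?i = pi"
    using Arg_real[of "edge_vector w (Suc j) / edge_vector w j"] 0
    by (simp only: outer_angle_def e edge_vector_mod complex_is_Real_iff) metis
  moreover have "outer_angle w ?i \<in> {-pi<..<pi} - {0}"
    using assms polygon_length[OF assms] by (auto simp: polygon_def)
  ultimately show False by auto
qed

lemma polygon_edge_nonzero: "polygon w \<Longrightarrow> edge_vector w j \<noteq> 0"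
  using polygon_edges_not_parallel[of w j] by auto

text \<open>
  The norm \<open>\<bar>s\<bar> + \<bar>t\<bar>\<close> of the coordinates with respect to a basis of the plane is dominated by the
  Euclidean norm. Used for two neighbouring edges, this says that they leave their common vertex at a
  definite angle.
\<close>

lemma independent_lower_bound:
  fixes a b :: complex
  assumes "Im (b / a) \<noteq> 0"
  obtains c where "0 < c" "\<And>s t. c * (\<bar>s\<bar> + \<bar>t\<bar>) \<le> norm (s *\<^sub>R a + t *\<^sub>R b)"
proof -
  define z where "z = b / a"
  have a: "a \<noteq> 0" and z: "Im z \<noteq> 0" using assms by (auto simp: z_def)
  define D where "D = 1 + (1 + norm z) / \<bar>Im z\<bar>"
  have D: "0 < D" unfolding D_def using z by (intro add_pos_nonneg divide_nonneg_nonneg) auto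
  have "\<bar>s\<bar> + \<bar>t\<bar> \<le> D * norm (s *\<^sub>R 1 + t *\<^sub>R z)" for s t
  proof -
    let ?n = "norm (s *\<^sub>R 1 + t *\<^sub>R z)"
    have "\<bar>t\<bar> * \<bar>Im z\<bar> \<le> ?n"
      using abs_Im_le_cmod[of "s *\<^sub>R 1 + t *\<^sub>R z"] by (simp add: abs_mult)
    then have t: "\<bar>t\<bar> \<le> ?n / \<bar>Im z\<bar>" using z by (simp add: field_simps)
    have "\<bar>s\<bar> \<le> ?n + \<bar>t\<bar> * norm z"
      using norm_triangle_ineq4[of "s *\<^sub>R 1 + t *\<^sub>R z" "t *\<^sub>R z"] by simp
    then have "\<bar>s\<bar> + \<bar>t\<bar> \<le> ?n + \<bar>t\<bar> * (1 + norm z)" by (simp add: algebra_simps)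
    also have "\<dots> \<le> ?n + ?n / \<bar>Im z\<bar> * (1 + norm z)" using t by (intro add_left_mono mult_right_mono) auto
    also have "\<dots> = D * ?n" by (simp add: D_def algebra_simps)
    finally show ?thesis .
  qed
  moreover have "norm (s *\<^sub>R a + t *\<^sub>R b) = norm a * norm (s *\<^sub>R 1 + t *\<^sub>R z)" for s t
  proof -
    have "s *\<^sub>R a + t *\<^sub>R b = a * (s *\<^sub>R 1 + t *\<^sub>R z)" using a by (simp add: z_def algebra_simps)
    then show ?thesis by (simp only: norm_mult)
  qed
  ultimately have "norm a / D * (\<bar>s\<bar> + \<bar>t\<bar>) \<le> norm (s *\<^sub>R a + t *\<^sub>R b)" for s t
    using D mult_left_mono[of "\<bar>s\<bar> + \<bar>t\<bar>" "D * norm (s *\<^sub>R 1 + t *\<^sub>R z)" "norm a"]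
    by (simp add: field_simps)
  then show thesis using that[of "norm a / D"] a D by simp
qed

text \<open>
  The displacement of the boundary of \<open>w\<close> is Lipschitz for pairs that consist of a point of the \<open>i\<close>-th
  side and one of the \<open>j\<close>-th side, with a constant linear in the displacement \<open>\<delta>\<close> of the vertices. One
  number \<open>L\<close> has to serve for all displaced polygons \<open>v\<close>.
\<close>

definition sides_controlled :: "complex list \<Rightarrow> nat \<Rightarrow> nat \<Rightarrow> real \<Rightarrow> bool" where
  "sides_controlled w i j L \<longleftrightarrow> 0 \<le> L \<and>
    (\<forall>v \<delta> s s'. length v = length w \<longrightarrow> (\<forall>k. norm (vertex v k - vertex w k) \<le> \<delta>) \<longrightarrow>
       s \<in> {0..1} \<longrightarrow> s' \<in> {0..1} \<longrightarrow>
       norm ((side v i s - side w i s) - (side v j s' - side w j s'))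
         \<le> L * \<delta> * norm (side w i s - side w j s'))"

lemma sides_controlledI:
  assumes "0 \<le> L"
    "\<And>v \<delta> s s'. \<lbrakk>length v = length w; \<And>k. norm (vertex v k - vertex w k) \<le> \<delta>;
       0 \<le> s; s \<le> 1; 0 \<le> s'; s' \<le> 1\<rbrakk> \<Longrightarrow>
     norm ((side v i s - side w i s) - (side v j s' - side w j s'))
         \<le> L * \<delta> * norm (side w i s - side w j s')"
  shows "sides_controlled w i j L"
  using assms by (auto simp: sides_controlled_def)

lemma sides_controlled_sym: "sides_controlled w i j L \<Longrightarrow> sides_controlled w j i L"
  unfolding sides_controlled_def by (simp add: norm_minus_commute)

text \<open>
  On one side the displacement is an affine function of the parameter.
\<close>

lemma same_side_controlled:
  assumes "polygon w"
  shows "\<exists>L. sides_controlled w i i L"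
proof -
  let ?e = "edge_vector w (Suc i)"
  have e: "?e \<noteq> 0" using assms by (rule polygon_edge_nonzero)
  have w: "w \<noteq> []" using assms by (rule polygon_length)
  have "sides_controlled w i i (2 / norm ?e)"
  proof (rule sides_controlledI)
    fix v \<delta> and s s' :: real
    assume v: "length v = length w" and \<delta>: "\<And>k. norm (vertex v k - vertex w k) \<le> \<delta>"
    have "v \<noteq> []" using v w by auto
    then have "(side v i s - side w i s) - (side v i s' - side w i s') =
        (s - s') *\<^sub>R ((vertex v (Suc i) - vertex w (Suc i)) - (vertex v i - vertex w i))"
      using w by (simp add: side_alt edge_vector_Suc algebra_simps)
    then have "norm ((side v i s - side w i s) - (side v i s' - side w i s')) \<le> \<bar>s - s'\<bar> * (2 * \<delta>)"
      using norm_triangle_le_diff[OF add_mono[OF \<delta>[of "Suc i"] \<delta>[of i]]]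
      by (simp add: mult_left_mono)
    also have "\<dots> = 2 / norm ?e * \<delta> * norm (side w i s - side w i s')"
      using w e by (simp add: side_alt flip: scaleR_left_diff_distrib)
    finally show "norm ((side v i s - side w i s) - (side v i s' - side w i s'))
         \<le> 2 / norm ?e * \<delta> * norm (side w i s - side w i s')" .
  qed simp
  then show ?thesis ..
qed

text \<open>
  Both the displacements and the points are compared through the common vertex. The two detours
  together are not longer than a constant times the direct distance since the edges are not parallel.
\<close>

lemma adjacent_sides_controlled:
  assumes "polygon w"
  shows "\<exists>L. sides_controlled w i (Suc i) L"
proof -
  let ?e = "edge_vector w (Suc i)" and ?e' = "edge_vector w (Suc (Suc i))"
  have w: "w \<noteq> []" using assms by (rule polygon_length)
  obtain c where c: "0 < c" "\<And>s t. c * (\<bar>s\<bar> + \<bar>t\<bar>) \<le> norm (s *\<^sub>R ?e + t *\<^sub>R ?e')"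
    using independent_lower_bound[OF polygon_edges_not_parallel[OF assms, of "Suc i"]] by blast
  have "sides_controlled w i (Suc i) (2 / c)"
  proof (rule sides_controlledI)
    fix v \<delta> and s s' :: real
    assume v: "length v = length w" and \<delta>: "\<And>k. norm (vertex v k - vertex w k) \<le> \<delta>"
      and s: "0 \<le> s" "s \<le> 1" "0 \<le> s'" "s' \<le> 1"
    define d where "d k = vertex v k - vertex w k" for k
    have nd: "norm (d (Suc k) - d k) \<le> 2 * \<delta>" for k
      unfolding d_def using norm_triangle_le_diff[OF add_mono[OF \<delta>[of "Suc k"] \<delta>[of k]]] by simp
    have "v \<noteq> []" using v w by auto
    then have "(side v i s - side w i s) - (side v (Suc i) s' - side w (Suc i) s') =
        - ((1 - s) *\<^sub>R (d (Suc i) - d i) + s' *\<^sub>R (d (Suc (Suc i)) - d (Suc i)))"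
      using w by (simp add: d_def side_alt edge_vector_Suc algebra_simps)
    then have "norm ((side v i s - side w i s) - (side v (Suc i) s' - side w (Suc i) s'))
        \<le> (1 - s) * (2 * \<delta>) + s' * (2 * \<delta>)"
      using s nd by (simp only: norm_minus_cancel)
        (intro norm_triangle_le add_mono, auto intro: mult_left_mono)
    also have "\<dots> = 2 / c * \<delta> * (c * (\<bar>1 - s\<bar> + \<bar>s'\<bar>))"
      using c(1) s by (simp add: field_simps)
    also have "\<dots> \<le> 2 / c * \<delta> * norm ((1 - s) *\<^sub>R ?e + s' *\<^sub>R ?e')"
      using c order_trans[OF norm_ge_zero \<delta>[of 0]] by (intro mult_left_mono) auto
    also have "(1 - s) *\<^sub>R ?e + s' *\<^sub>R ?e' = - (side w i s - side w (Suc i) s')"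
      using w by (simp add: side_alt edge_vector_Suc algebra_simps)
    finally show "norm ((side v i s - side w i s) - (side v (Suc i) s' - side w (Suc i) s'))
         \<le> 2 / c * \<delta> * norm (side w i s - side w (Suc i) s')"
      by (simp only: norm_minus_cancel)
  qed (use c in simp)
  then show ?thesis ..
qed

text \<open>
  Two disjoint sides have a positive distance, so that the crude bound \<open>2 \<delta>\<close> is enough.
\<close>

lemma disjoint_sides_controlled:
  assumes "side w i ` {0..1} \<inter> side w j ` {0..1} = {}"
  shows "\<exists>L. sides_controlled w i j L"
proof -
  obtain d where d: "0 < d" "\<And>x y. x \<in> side w i ` {0..1} \<Longrightarrow> y \<in> side w j ` {0..1} \<Longrightarrow> d \<le> dist x y"
    using separate_compact_closed[OF compact_side compact_imp_closed[OF compact_side] assms] by blast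
  have "sides_controlled w i j (2 / d)"
  proof (rule sides_controlledI)
    fix v \<delta> and s s' :: real
    assume \<delta>: "\<And>k. norm (vertex v k - vertex w k) \<le> \<delta>"
      and s: "0 \<le> s" "s \<le> 1" "0 \<le> s'" "s' \<le> 1"
    have n: "norm (side v k r - side w k r) \<le> \<delta>" if "0 \<le> r" "r \<le> 1" for k r
    proof -
      have "side v k r - side w k r =
          (1 - r) *\<^sub>R (vertex v k - vertex w k) + r *\<^sub>R (vertex v (Suc k) - vertex w (Suc k))"
        by (simp add: side_def linepath_def algebra_simps)
      also have "norm \<dots> \<le> (1 - r) * \<delta> + r * \<delta>"
        using that \<delta> by (intro norm_triangle_le add_mono) (auto intro: mult_left_mono)
      finally show ?thesis by (simp add: algebra_simps)
    qed
    have "norm ((side v i s - side w i s) - (side v j s' - side w j s')) \<le> 2 / d * \<delta> * d"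
      using norm_triangle_le_diff[OF add_mono[OF n[of s i] n[of s' j]]] s d(1) by simp
    also have "\<dots> \<le> 2 / d * \<delta> * norm (side w i s - side w j s')"
      using d(2)[of "side w i s" "side w j s'"] d(1) s order_trans[OF norm_ge_zero \<delta>[of 0]]
      by (intro mult_left_mono) (auto simp: dist_norm)
    finally show "norm ((side v i s - side w i s) - (side v j s' - side w j s'))
         \<le> 2 / d * \<delta> * norm (side w i s - side w j s')" .
  qed (use d in simp)
  then show ?thesis ..
qed

lemma polygon_sides_controlled:
  assumes w: "polygon w" and "i < length w" "j < length w"
  shows "\<exists>L. sides_controlled w i j L"
proof -
  have less: "\<exists>L. sides_controlled w i j L" if ij: "i < j" "j < length w" for i j
  proof (cases "j = Suc i \<or> i = 0 \<and> Suc j = length w")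
    case True
    then show ?thesis
    proof
      assume "i = 0 \<and> Suc j = length w"
      then have "side u (Suc j) = side u i" if "length u = length w" for u
        using side_mod[of u "Suc j"] that by simp
      moreover obtain L where "sides_controlled w j (Suc j) L"
        using adjacent_sides_controlled[OF w] by blast
      ultimately have "sides_controlled w j i L" by (auto simp: sides_controlled_def)
      then show ?thesis using sides_controlled_sym by blast
    qed (use adjacent_sides_controlled[OF w] in blast)
  next
    case False
    have "simple_path (boundary_path w)" using w by (simp add: polygon_def)
    then have "side w i ` {0..1} \<inter> side w j ` {0..1} = {}"
      using simple_sides_meet[of w i j] ij False by fastforce
    then show ?thesis by (rule disjoint_sides_controlled)
  qed
  show ?thesis
    using less[of i j] less[of j i] assms same_side_controlled[OF w, of i] sides_controlled_sym
    by (metis linorder_neqE_nat)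
qed

lemma boundary_path_perturbation:
  assumes w: "polygon w"
  obtains L where "0 \<le> L" "\<And>v \<delta> t t'. \<lbrakk>length v = length w; \<And>k. norm (vertex v k - vertex w k) \<le> \<delta>;
     t \<in> {0..1}; t' \<in> {0..1}\<rbrakk> \<Longrightarrow>
     norm ((boundary_path v t - boundary_path w t) - (boundary_path v t' - boundary_path w t'))
       \<le> L * \<delta> * norm (boundary_path w t - boundary_path w t')"
proof -
  obtain Lc where Lc: "\<And>i j. i < length w \<Longrightarrow> j < length w \<Longrightarrow> sides_controlled w i j (Lc i j)"
    using polygon_sides_controlled[OF w] by metis
  define L where "L = (\<Sum>i<length w. \<Sum>j<length w. Lc i j)"
  have nn: "0 \<le> Lc i j" if "i < length w" "j < length w" for i j
    using Lc[OF that] by (simp add: sides_controlled_def)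
  have le: "Lc i j \<le> L" if "i < length w" "j < length w" for i j
  proof -
    have "Lc i j \<le> (\<Sum>j<length w. Lc i j)"
      using that nn by (intro member_le_sum) auto
    also have "\<dots> \<le> L" unfolding L_def
      using that nn by (intro member_le_sum[where f = "\<lambda>i. \<Sum>j<length w. Lc i j"] sum_nonneg) auto
    finally show ?thesis .
  qed
  show thesis
  proof (rule that)
    show "0 \<le> L" unfolding L_def using nn by (intro sum_nonneg) auto
    fix v \<delta> and t t' :: real
    assume v: "length v = length w" and \<delta>: "\<And>k. norm (vertex v k - vertex w k) \<le> \<delta>"
      and t: "t \<in> {0..1}" "t' \<in> {0..1}"
    have "w \<noteq> []" using w by (rule polygon_length)
    from boundary_path_cover[OF this t(1)] boundary_path_cover[OF this t(2)]
    obtain i s j s' where i: "i < length w" "0 \<le> s" "s \<le> 1"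
        "\<And>v. length v = length w \<Longrightarrow> boundary_path v t = side v i s"
      and j: "j < length w" "0 \<le> s'" "s' \<le> 1"
        "\<And>v. length v = length w \<Longrightarrow> boundary_path v t' = side v j s'"
      by metis
    have "norm ((side v i s - side w i s) - (side v j s' - side w j s'))
         \<le> Lc i j * \<delta> * norm (side w i s - side w j s')"
      using Lc[OF i(1) j(1)] v \<delta> i j by (simp add: sides_controlled_def)
    also have "\<dots> \<le> L * \<delta> * norm (side w i s - side w j s')"
      using le[OF i(1) j(1)] order_trans[OF norm_ge_zero \<delta>[of 0]]
      by (intro mult_right_mono) auto
    finally show "norm ((boundary_path v t - boundary_path w t) - (boundary_path v t' - boundary_path w t'))
       \<le> L * \<delta> * norm (boundary_path w t - boundary_path w t')"
      using i(4) j(4) v by simp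
  qed
qed

section \<open>The height vectors of a class of polygons form an open set\<close>

text \<open>
  An interior point of a side has a positive distance from all other sides, hence near it the curve is
  a piece of the line through that side.
\<close>

lemma polygon_locally_flat:
  assumes simple: "simple_path (boundary_path v)" and i: "i < length v" and s: "0 < s" "s < 1"
  obtains e where "0 < e" "\<And>z. \<lbrakk>z \<in> path_image (boundary_path v); dist (side v i s) z < e\<rbrakk> \<Longrightarrow>
    \<exists>r. z = side v i s + r *\<^sub>R edge_vector v (Suc i)"
proof -
  have v: "v \<noteq> []" using i by auto
  define R where "R = (\<Union>j\<in>{..<length v} - {i}. side v j ` {0..1})"
  have "closed R" unfolding R_def
    by (intro closed_UN ballI compact_imp_closed compact_side) auto
  moreover have "side v i s \<notin> R"
    unfolding R_def using simple_side_interior[OF simple i _ s] by force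
  ultimately obtain e where e: "0 < e" "ball (side v i s) e \<subseteq> - R"
    by (metis ComplI open_Compl open_contains_ball)
  show thesis
  proof (rule that[OF e(1)])
    fix z assume "z \<in> path_image (boundary_path v)" and d: "dist (side v i s) z < e"
    then obtain t where t: "t \<in> {0..1}" "z = boundary_path v t" by (auto simp: path_image_def)
    obtain j s' where j: "j < length v" "0 \<le> s'" "s' \<le> 1" "z = side v j s'"
      using boundary_path_cover[OF v t(1)] t(2) by metis
    have "z \<notin> R" using e(2) d by auto
    moreover have "z \<in> side v j ` {0..1}" using j by simp
    ultimately have "j = i" using j(1) unfolding R_def by blast
    then have "z = side v i s + (s' - s) *\<^sub>R edge_vector v (Suc i)"
      using j(4) v by (simp add: side_alt algebra_simps)
    then show "\<exists>r. z = side v i s + r *\<^sub>R edge_vector v (Suc i)" ..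
  qed
qed

text \<open>
  Moving the vertices slightly, while keeping the directions of the edges, does not leave the class: the
  map \<open>\<Phi> = id + g\<close> built from the displacement along the boundary is a homeomorphism of the plane that
  carries one boundary path to the other with the same parameter.
\<close>

lemma polygon_stability:
  assumes w: "polygon w"
  obtains \<epsilon> where "0 < \<epsilon>" "\<And>v. \<lbrakk>length v = length w; \<And>k. norm (vertex v k - vertex w k) \<le> \<epsilon>;
      \<And>j. \<exists>r>0. edge_vector v j = r *\<^sub>R edge_vector w j\<rbrakk> \<Longrightarrow>
      polygon v \<and> (\<forall>j n. outward_unit_normal w j n \<longrightarrow> outward_unit_normal v j n)"
proof -
  obtain L where L: "0 \<le> L" "\<And>v \<delta> t t'. \<lbrakk>length v = length w; \<And>k. norm (vertex v k - vertex w k) \<le> \<delta>;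
     t \<in> {0..1}; t' \<in> {0..1}\<rbrakk> \<Longrightarrow>
     norm ((boundary_path v t - boundary_path w t) - (boundary_path v t' - boundary_path w t'))
       \<le> L * \<delta> * norm (boundary_path w t - boundary_path w t')"
    using boundary_path_perturbation[OF w] by blast
  \<comment> \<open>With this choice the extended displacement has the Lipschitz constant \<open>K \<le> 1 / 2\<close>.\<close>
  define \<epsilon> where "\<epsilon> = 1 / (4 * (L + 1))"
  define K where "K = 2 * (L * \<epsilon>)"
  have \<epsilon>: "0 < \<epsilon>" and K: "K < 1" using L(1) by (auto simp: \<epsilon>_def K_def field_simps)
  have wne: "w \<noteq> []" and ws: "simple_path (boundary_path w)" using w polygon_length by (auto simp: polygon_def)
  show thesis
  proof (rule that[OF \<epsilon>], intro conjI allI impI)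
    fix v assume v: "length v = length w" "\<And>k. norm (vertex v k - vertex w k) \<le> \<epsilon>"
      and ev: "\<And>j. \<exists>r>0. edge_vector v j = r *\<^sub>R edge_vector w j"
    have vne: "v \<noteq> []" using v wne by auto
    have "norm ((boundary_path v t - boundary_path w t) - (boundary_path v t' - boundary_path w t'))
        \<le> L * \<epsilon> * dist (boundary_path w t) (boundary_path w t')" if "t \<in> {0..1}" "t' \<in> {0..1}" for t t'
      using L(2)[OF v that] by (simp only: dist_norm)
    then obtain g where g: "K-lipschitz_on UNIV g"
      "\<And>t. t \<in> {0..1} \<Longrightarrow> g (boundary_path w t) = boundary_path v t - boundary_path w t"
      using lipschitz_extension_complex[of "{0..1::real}" "L * \<epsilon>"
          "\<lambda>t. boundary_path v t - boundary_path w t" "boundary_path w" thesis] L(1) \<epsilon>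
      unfolding K_def by simp
    define \<Phi> where "\<Phi> = (\<lambda>x. x + g x)"
    have \<Phi>: "\<Phi> (boundary_path w t) = boundary_path v t" if "t \<in> {0..1}" for t
      using g(2)[OF that] by (simp add: \<Phi>_def)
    have image: "path_image (boundary_path v) = \<Phi> ` path_image (boundary_path w)"
      unfolding path_image_def using \<Phi> by (force simp: image_image)
    have "path (boundary_path w)" "loop_free (boundary_path w)" using ws by (auto simp: simple_path_def)
    have "continuous_on {0..1} (\<lambda>t. \<Phi> (boundary_path w t))"
      using \<open>path (boundary_path w)\<close> unfolding \<Phi>_def path_def
      by (rule continuous_on_compose2[OF perturbed_id_continuous[OF g(1) K]]) auto
    then have "path (boundary_path v)"
      unfolding path_def using \<Phi> by (simp cong: continuous_on_cong_simp)
    moreover have "loop_free (boundary_path v)"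
      using \<open>loop_free (boundary_path w)\<close> \<Phi> perturbed_id_inj[OF g(1) K]
      unfolding loop_free_def by (metis \<Phi>_def)
    ultimately have simple: "simple_path (boundary_path v)" by (simp add: simple_path_def)
    have closed: "pathfinish (boundary_path w) = pathstart (boundary_path w)"
    proof -
      obtain a xs where w: "w = a # xs" using wne by (cases w) auto
      then show ?thesis
        using pathstart_polygonal_path[of a "xs @ [a]"] pathfinish_polygonal_path[of "w @ [a]"]
        by (simp add: boundary_path_def)
    qed
    show "polygon v" unfolding polygon_def
    proof (intro conjI ballI allI impI)
      show "3 \<le> length v" using polygon_length(1)[OF w] v by simp
      show "simple_path (boundary_path v)" by fact
      show "winding_number (boundary_path v) z = 1" if z: "z \<in> inside (path_image (boundary_path v))" for z
      proof -
        obtain x where x: "x \<in> inside (path_image (boundary_path w))" "z = x + g x"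
          using perturbed_id_inside[OF g(1) K z[unfolded image \<Phi>_def]] by blast
        have "x \<notin> path_image (boundary_path w)" using x(1) inside_no_overlap by blast
        then have "winding_number (\<lambda>s. \<Phi> (boundary_path w s)) z = winding_number (boundary_path w) x"
          unfolding \<Phi>_def x(2)
          using \<open>path (boundary_path w)\<close> closed by (intro perturbed_id_winding_number[OF g(1) K])
        moreover have "winding_number (boundary_path v) z = winding_number (\<lambda>s. \<Phi> (boundary_path w s)) z"
          using \<Phi> by (intro winding_number_cong) simp
        ultimately show ?thesis using w x(1) by (simp add: polygon_def)
      qed
      show "outer_angle v j \<in> {-pi<..<pi} - {0}" if j: "j < length v" for j
      proof -
        obtain r r' where r: "0 < r" "0 < r'" "edge_vector v j = r *\<^sub>R edge_vector w j"
          "edge_vector v (Suc j) = r' *\<^sub>R edge_vector w (Suc j)" using ev by metis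
        have "edge_vector v (Suc j) / edge_vector v j =
            complex_of_real (r' / r) * (edge_vector w (Suc j) / edge_vector w j)"
          by (simp add: r scaleR_conv_of_real)
        then have "outer_angle v j = outer_angle w j"
          unfolding outer_angle_def Suc_eq_plus1[symmetric] using r by (simp only: Arg_times_of_real divide_pos_pos)
        then show ?thesis using w v j by (simp add: polygon_def)
      qed
    qed
    fix j n assume n: "outward_unit_normal w j n"
    obtain r where r: "0 < r" "edge_vector v j = r *\<^sub>R edge_vector w j" using ev by blast
    define i where "i = (j + length w - 1) mod length w"
    have i: "i < length w" using wne by (simp add: i_def)
    have ends: "vertex u i = vertex u (j + length u - 1)" "vertex u (Suc i) = vertex u j"
      "edge_vector u (Suc i) = edge_vector u j" if "length u = length w" for u
    proof -
      have "Suc i mod length w = Suc (j + length w - 1) mod length w"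
        unfolding i_def by (rule mod_Suc_eq)
      also have "Suc (j + length w - 1) = j + length w" using wne by (cases w) auto
      finally have *: "Suc i mod length w = j mod length w" by simp
      show "vertex u i = vertex u (j + length u - 1)" by (simp add: i_def vertex_def that)
      show "vertex u (Suc i) = vertex u j" by (simp add: vertex_def that *)
      show "edge_vector u (Suc i) = edge_vector u j"
        using edge_vector_mod[of u "Suc i"] edge_vector_mod[of u j] that * by simp
    qed
    have unit: "n \<bullet> n = 1" "norm n = 1" and perp: "n \<bullet> edge_vector v j = 0"
      using n r by (auto simp: outward_unit_normal_def dot_square_norm)
    show "outward_unit_normal v j n" unfolding outward_unit_normal_def
    proof (intro conjI ballI)
      fix x assume "x \<in> edge v j"
      then obtain s where s: "0 < s" "s < 1" "x = side v i s"
        using ends[OF v(1)] by (auto simp: edge_def in_segment side_def linepath_def)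
      define y where "y = side w i s"
      have "vertex w i \<noteq> vertex w (Suc i)"
        using polygon_edge_nonzero[OF w, of "Suc i"] edge_vector_Suc[OF wne] by auto
      then have "y \<in> edge w j"
        using ends[of w] s by (auto simp: edge_def in_segment side_def linepath_def y_def)
      define t where "t = knot (length w) i + s * (knot (length w) (Suc i) - knot (length w) i)"
      have "knot (length w) i < knot (length w) (Suc i)" using i by (intro knot_less) auto
      then have "0 \<le> s * (knot (length w) (Suc i) - knot (length w) i)"
          "s * (knot (length w) (Suc i) - knot (length w) i) \<le> knot (length w) (Suc i) - knot (length w) i"
        using s mult_right_mono[of s 1 "knot (length w) (Suc i) - knot (length w) i"] by auto
      then have t: "t \<in> {0..1}"
        using knot_bounds[of i "length w"] knot_bounds[of "Suc i" "length w"] i by (simp add: t_def)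
      have "boundary_path w t = y" "boundary_path v t = x"
        unfolding t_def y_def s(3)
        using boundary_path_knot[of i w s] boundary_path_knot[of i v s] i s v(1) by auto
      then have xy: "x = \<Phi> y" using \<Phi>[OF t] by simp
      \<comment> \<open>A point \<open>y + \<eta> n\<close> outside \<open>w\<close> is mapped to a point \<open>z\<close> outside \<open>v\<close> that is closer than \<open>\<eta>\<close> to
        \<open>x + \<eta> n\<close>. The segment between these two points stays on the side of \<open>n\<close> of the line through the
        edge and near \<open>x\<close>, where the curve lies on that line. So the segment misses the curve.\<close>
      obtain e where e: "0 < e" "\<And>z. \<lbrakk>z \<in> path_image (boundary_path v); dist x z < e\<rbrakk> \<Longrightarrow>
          \<exists>r. z = x + r *\<^sub>R edge_vector v j"
        using polygon_locally_flat[OF simple _ s(1,2)] i v(1) s(3) ends(3)[OF v(1)] by metis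
      have "\<forall>\<^sub>F \<eta> in at_right 0. y + \<eta> *\<^sub>R n \<in> outside (path_image (boundary_path w))"
        using n \<open>y \<in> edge w j\<close> by (simp add: outward_unit_normal_def)
      moreover have "\<forall>\<^sub>F \<eta> in at_right 0. 0 < \<eta> \<and> \<eta> < e / 2"
        using e(1) by (auto simp: eventually_at_right_field intro!: exI[of _ "e / 2"])
      ultimately show "\<forall>\<^sub>F \<eta> in at_right 0. x + \<eta> *\<^sub>R n \<in> outside (path_image (boundary_path v))"
      proof eventually_elim
        case (elim \<eta>)
        define z where "z = \<Phi> (y + \<eta> *\<^sub>R n)"
        have z: "z \<in> outside (path_image (boundary_path v))"
          unfolding z_def image \<Phi>_def using elim by (intro perturbed_id_outside[OF g(1) K]) simp
        have "norm (z - x - \<eta> *\<^sub>R n) \<le> K * \<eta>"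
          using perturbed_id_diff[OF g(1) K, of "y + \<eta> *\<^sub>R n" y] elim unit
          by (simp add: z_def xy \<Phi>_def algebra_simps)
        moreover have "K * \<eta> < \<eta>" using K elim by simp
        ultimately have near: "norm (c - (x + \<eta> *\<^sub>R n)) < \<eta>" if "c \<in> closed_segment (x + \<eta> *\<^sub>R n) z" for c
          using segment_bound1[OF that] by (simp add: algebra_simps norm_minus_commute)
        have "c \<notin> path_image (boundary_path v)" if c: "c \<in> closed_segment (x + \<eta> *\<^sub>R n) z" for c
        proof
          assume "c \<in> path_image (boundary_path v)"
          moreover have "dist x c < e"
          proof -
            have "norm (c - x) \<le> norm (c - (x + \<eta> *\<^sub>R n)) + norm (\<eta> *\<^sub>R n)"
              using norm_triangle_ineq[of "c - (x + \<eta> *\<^sub>R n)" "\<eta> *\<^sub>R n"] by simp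
            then show ?thesis using near[OF c] elim unit by (simp add: dist_norm norm_minus_commute)
          qed
          ultimately obtain r where "c = x + r *\<^sub>R edge_vector v j" using e(2) by blast
          then have "n \<bullet> (c - (x + \<eta> *\<^sub>R n)) = - \<eta>"
            using perp unit by (simp add: inner_diff_right inner_add_right)
          moreover have "\<bar>n \<bullet> (c - (x + \<eta> *\<^sub>R n))\<bar> \<le> norm n * norm (c - (x + \<eta> *\<^sub>R n))"
            by (rule Cauchy_Schwarz_ineq2)
          ultimately show False using near[OF c] unit elim by simp
        qed
        then have "connected_component (- path_image (boundary_path v)) z (x + \<eta> *\<^sub>R n)"
          by (intro connected_componentI[of "closed_segment (x + \<eta> *\<^sub>R n) z"]) auto
        then show ?case using outside_same_component z by blast
      qed
    qed (use unit perp in auto)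
  qed
qed

text \<open>
  With \<open>a\<close> and \<open>b\<close> the two edges at a vertex, \<open>n\<close> and \<open>n'\<close> their normals: a shift along \<open>b\<close> changes
  only the height of the edge \<open>a\<close>, and a shift along \<open>a\<close> only that of \<open>b\<close>. So any changes \<open>p\<close> and \<open>q\<close> of
  the two heights are realised by a shift \<open>d\<close> of the vertex.
\<close>

lemma displacement_of_heights:
  fixes a b n n' :: complex
  assumes "n \<bullet> a = 0" "n' \<bullet> b = 0" "n \<noteq> 0" "n' \<noteq> 0" "Im (b / a) \<noteq> 0"
  obtains C where "0 \<le> C"
    "\<And>p q. \<exists>d. n \<bullet> d = p \<and> n' \<bullet> d = q \<and> norm d \<le> C * (\<bar>p\<bar> + \<bar>q\<bar>)"
proof -
  have nb: "n \<bullet> b \<noteq> 0" using parallel_complex[of n b a] assms by auto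
  have "Im (a / b) \<noteq> 0" using assms(5) by (auto simp: Im_divide algebra_simps)
  then have na: "n' \<bullet> a \<noteq> 0" using parallel_complex[of n' a b] assms by auto
  define C where "C = norm b / \<bar>n \<bullet> b\<bar> + norm a / \<bar>n' \<bullet> a\<bar>"
  show thesis
  proof (rule that[of C])
    show "0 \<le> C" by (simp add: C_def)
    fix p q :: real
    let ?d = "(p / (n \<bullet> b)) *\<^sub>R b + (q / (n' \<bullet> a)) *\<^sub>R a"
    have "norm ?d \<le> \<bar>p\<bar> * (norm b / \<bar>n \<bullet> b\<bar>) + \<bar>q\<bar> * (norm a / \<bar>n' \<bullet> a\<bar>)"
      by (rule order_trans[OF norm_triangle_ineq]) simp
    also have "\<dots> \<le> \<bar>p\<bar> * C + \<bar>q\<bar> * C"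
      by (intro add_mono mult_left_mono) (auto simp: C_def)
    finally have "norm ?d \<le> C * (\<bar>p\<bar> + \<bar>q\<bar>)" by (simp add: algebra_simps)
    moreover have "n \<bullet> ?d = p" "n' \<bullet> ?d = q"
      using assms na nb by (simp_all add: inner_add_right)
    ultimately show "\<exists>d. n \<bullet> d = p \<and> n' \<bullet> d = q \<and> norm d \<le> C * (\<bar>p\<bar> + \<bar>q\<bar>)" by blast
  qed
qed

lemma positive_multiple:
  fixes n a b :: complex
  assumes "n \<noteq> 0" "n \<bullet> a = 0" "n \<bullet> b = 0" "norm (b - a) < norm a"
  shows "\<exists>r>0. b = r *\<^sub>R a"
proof -
  have a: "a \<noteq> 0" using assms by auto
  have "b / a \<in> \<real>" using parallel_complex[OF assms(1,3,2)] by (simp add: complex_is_Real_iff)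
  then obtain r where r: "b = r *\<^sub>R a"
    using a by (metis Reals_cases nonzero_eq_divide_eq scaleR_conv_of_real)
  then have "b - a = (r - 1) *\<^sub>R a" by (simp add: algebra_simps)
  then have "\<bar>r - 1\<bar> * norm a < 1 * norm a" using assms(4) by simp
  then have "\<bar>r - 1\<bar> < 1" using a mult_less_cancel_right_pos zero_less_norm_iff by blast
  then show ?thesis using r by (intro exI[of _ r]) auto
qed

text \<open>
  Each vertex is shifted so that its two edges get their prescribed heights; each edge then has the
  same height at both of its ends, so it is still perpendicular to its normal, and being close to the old
  edge it is a positive multiple of it.
\<close>

lemma polygon_class_heights_open:
  assumes w: "w \<in> polygon_class \<nu>"
  obtains \<eta> where "0 < \<eta>" "\<And>x. (\<And>j. j < length \<nu> \<Longrightarrow> \<bar>x j - height \<nu> w j\<bar> \<le> \<eta>) \<Longrightarrow>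
    \<exists>v\<in>polygon_class \<nu>. \<forall>j<length \<nu>. height \<nu> v j = x j"
proof -
  let ?N = "length \<nu>"
  have pw: "polygon w" and len: "length w = ?N"
    and out: "\<And>j. j < ?N \<Longrightarrow> outward_unit_normal w j (\<nu> ! j)"
    using w by (auto simp: polygon_class_def)
  have wne: "w \<noteq> []" using pw by (rule polygon_length)
  then have N: "0 < ?N" using len by auto
  define n where "n j = \<nu> ! (j mod ?N)" for j
  have n0: "n j \<noteq> 0" and perp: "n j \<bullet> edge_vector w j = 0" for j
    using out[of "j mod ?N"] N edge_vector_mod[of w j] len
    by (auto simp: outward_unit_normal_def n_def)
  have "\<exists>C\<ge>0. \<forall>p q. \<exists>d. n j \<bullet> d = p \<and> n (Suc j) \<bullet> d = q \<and> norm d \<le> C * (\<bar>p\<bar> + \<bar>q\<bar>)" for j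
    using displacement_of_heights[OF perp[of j] perp[of "Suc j"] n0 n0 polygon_edges_not_parallel[OF pw]]
    by metis
  then obtain C D where C: "\<And>j. 0 \<le> C j"
    and D: "\<And>j p q. n j \<bullet> D j p q = p \<and> n (Suc j) \<bullet> D j p q = q \<and> norm (D j p q) \<le> C j * (\<bar>p\<bar> + \<bar>q\<bar>)"
    by metis
  define B where "B = (\<Sum>j<?N. C j) + 1"
  have B: "0 < B" unfolding B_def using C by (intro add_nonneg_pos sum_nonneg) auto
  have CB: "C j \<le> B" if "j < ?N" for j
    using member_le_sum[of j "{..<?N}" C] C that by (simp add: B_def)
  obtain \<epsilon> where \<epsilon>: "0 < \<epsilon>" "\<And>v. \<lbrakk>length v = length w; \<And>k. norm (vertex v k - vertex w k) \<le> \<epsilon>;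
      \<And>j. \<exists>r>0. edge_vector v j = r *\<^sub>R edge_vector w j\<rbrakk> \<Longrightarrow>
      polygon v \<and> (\<forall>j n. outward_unit_normal w j n \<longrightarrow> outward_unit_normal v j n)"
    using polygon_stability[OF pw] by blast
  define m where "m = Min ((\<lambda>j. norm (edge_vector w j)) ` {..<?N})"
  have m: "0 < m" unfolding m_def using N polygon_edge_nonzero[OF pw] by (subst Min_gr_iff) auto
  have mle: "m \<le> norm (edge_vector w j)" for j
  proof -
    have "m \<le> norm (edge_vector w (j mod ?N))" unfolding m_def using N by (intro Min_le) auto
    then show ?thesis using edge_vector_mod[of w j] len by simp
  qed
  \<comment> \<open>The vertices move by at most \<open>2 B \<eta>\<close>: at most \<open>\<epsilon>\<close> for the stability of the polygon, and at most
    a third of every edge so that no edge vector can be reversed.\<close>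
  define \<eta> where "\<eta> = min \<epsilon> (m / 3) / (2 * B)"
  have \<eta>: "0 < \<eta>" using \<epsilon>(1) m B by (simp add: \<eta>_def)
  show thesis
  proof (rule that[OF \<eta>])
    fix x :: "nat \<Rightarrow> real" assume x: "\<And>j. j < ?N \<Longrightarrow> \<bar>x j - height \<nu> w j\<bar> \<le> \<eta>"
    define p where "p j = x (j mod ?N) - height \<nu> w (j mod ?N)" for j
    have p: "\<bar>p j\<bar> \<le> \<eta>" for j using x[of "j mod ?N"] N by (simp add: p_def)
    define d where "d j = D (j mod ?N) (p j) (p (Suc j))" for j
    have d: "n j \<bullet> d j = p j" "n (Suc j) \<bullet> d j = p (Suc j)" for j
      using D[of "j mod ?N" "p j" "p (Suc j)"] by (auto simp: d_def n_def mod_Suc_eq)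
    have "norm (d j) \<le> B * (\<eta> + \<eta>)" for j
    proof -
      have "norm (d j) \<le> C (j mod ?N) * (\<bar>p j\<bar> + \<bar>p (Suc j)\<bar>)" using D by (simp add: d_def)
      also have "\<dots> \<le> B * (\<eta> + \<eta>)" using CB[of "j mod ?N"] N B p by (intro mult_mono add_mono) auto
      finally show ?thesis .
    qed
    moreover have "B * (\<eta> + \<eta>) = min \<epsilon> (m / 3)" using B by (simp add: \<eta>_def)
    ultimately have nd: "norm (d j) \<le> \<epsilon>" "norm (d j) \<le> m / 3" for j by (metis min.boundedE)+
    define v where "v = map (\<lambda>j. w ! j + d j) [0..<?N]"
    have lv: "length v = length w" by (simp add: v_def len)
    have vv: "vertex v k = vertex w k + d k" for k
    proof -
      have "vertex v k = vertex w k + d (k mod ?N)" using N by (simp add: vertex_def v_def len)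
      also have "d (k mod ?N) = d k" by (simp add: d_def p_def mod_Suc_eq)
      finally show ?thesis .
    qed
    have vne: "v \<noteq> []" using lv wne by auto
    have perp': "n (Suc j) \<bullet> edge_vector v (Suc j) = 0" for j
      using d(1)[of "Suc j"] d(2)[of j] perp[of "Suc j"]
      by (simp add: edge_vector_Suc[OF vne] edge_vector_Suc[OF wne] vv inner_diff_right inner_add_right)
    have mult_Suc: "\<exists>r>0. edge_vector v (Suc j) = r *\<^sub>R edge_vector w (Suc j)" for j
    proof (rule positive_multiple[OF n0 perp perp'])
      have "edge_vector v (Suc j) - edge_vector w (Suc j) = d (Suc j) - d j"
        by (simp add: edge_vector_Suc[OF vne] edge_vector_Suc[OF wne] vv)
      then have "norm (edge_vector v (Suc j) - edge_vector w (Suc j)) \<le> m / 3 + m / 3"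
        using norm_triangle_le_diff[OF add_mono[OF nd(2)[of "Suc j"] nd(2)[of j]]] by simp
      also have "\<dots> < m" using m by simp
      finally show "norm (edge_vector v (Suc j) - edge_vector w (Suc j)) < norm (edge_vector w (Suc j))"
        using mle[of "Suc j"] by linarith
    qed
    have mult: "\<exists>r>0. edge_vector v j = r *\<^sub>R edge_vector w j" for j
    proof -
      \<comment> \<open>Adding \<open>N\<close> to the index makes it a successor also for \<open>j = 0\<close>.\<close>
      have "edge_vector u j = edge_vector u (Suc (j + ?N - 1))" if "length u = ?N" for u
        using edge_vector_mod[of u j] edge_vector_mod[of u "j + ?N"] that N by simp
      then show ?thesis using mult_Suc[of "j + ?N - 1"] lv len by metis
    qed
    have "polygon v \<and> (\<forall>j n. outward_unit_normal w j n \<longrightarrow> outward_unit_normal v j n)"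
      using nd(1) mult by (intro \<epsilon>(2) lv) (simp_all add: vv)
    then have "v \<in> polygon_class \<nu>" using lv len out by (simp add: polygon_class_def)
    moreover have "height \<nu> v j = x j" if "j < ?N" for j
      using d(1)[of j] that by (simp add: height_def vv p_def n_def inner_add_left inner_add_right inner_commute)
    ultimately show "\<exists>v\<in>polygon_class \<nu>. \<forall>j<?N. height \<nu> v j = x j" by blast
  qed
qed

section \<open>Consistency of the midpoint rule\<close>

text \<open>
  The properties demanded of \<open>\<omega>\<close>. Only positive steps occur, hence monotonicity is asked on \<open>{0<..}\<close>.
\<close>

definition convergence_rate :: "nat \<Rightarrow> (real \<Rightarrow> real) \<Rightarrow> bool" where
  "convergence_rate k \<omega> \<longleftrightarrow> mono_on {0<..} \<omega> \<and> (\<forall>a>0. 0 < \<omega> a) \<and>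
     (k \<in> {0, 1} \<longrightarrow> \<omega> \<in> o[at_right 0](\<lambda>a. a ^ k)) \<and>
     (k = 2 \<longrightarrow> \<omega> \<in> O[at_right 0](\<lambda>a. a ^ 2))"

lemma convergence_rate_sum:
  assumes "finite I" "I \<noteq> {}" "\<And>i. i \<in> I \<Longrightarrow> convergence_rate k (\<omega> i)"
  shows "convergence_rate k (\<lambda>a. \<Sum>i\<in>I. \<omega> i a)"
  unfolding convergence_rate_def
proof (intro conjI impI allI)
  show "mono_on {0<..} (\<lambda>a. \<Sum>i\<in>I. \<omega> i a)"
    using assms(3) by (auto simp: convergence_rate_def monotone_on_def intro!: sum_mono)
  show "0 < (\<Sum>i\<in>I. \<omega> i a)" if "0 < a" for a
    using assms that by (auto simp: convergence_rate_def intro!: sum_pos)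
  show "(\<lambda>a. \<Sum>i\<in>I. \<omega> i a) \<in> o[at_right 0](\<lambda>a. a ^ k)" if "k \<in> {0, 1}"
    using assms(3) that by (intro big_sum_in_smallo) (auto simp: convergence_rate_def)
  show "(\<lambda>a. \<Sum>i\<in>I. \<omega> i a) \<in> O[at_right 0](\<lambda>a. a ^ 2)" if "k = 2"
    using assms(3) that by (intro big_sum_in_bigo) (simp add: convergence_rate_def)
qed

lemma convergence_rate_cmult:
  assumes "0 < c" "convergence_rate k \<omega>"
  shows "convergence_rate k (\<lambda>a. c * \<omega> a)"
  unfolding convergence_rate_def
proof (intro conjI impI allI)
  show "mono_on {0<..} (\<lambda>a. c * \<omega> a)"
    using assms by (auto simp: convergence_rate_def monotone_on_def)
qed (use assms in \<open>auto simp: convergence_rate_def\<close>)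

lemma convergence_rate_small:
  assumes "convergence_rate k \<omega>" "k \<in> {0, 1, 2}" "0 < e"
  obtains a where "0 < a" "\<omega> a \<le> e"
proof -
  have "\<omega> \<in> o[at_right 0](\<lambda>a. 1)"
  proof -
    consider "k = 0" | "k = 1" | "k = 2" using assms(2) by auto
    then show ?thesis
    proof cases
      case 1 then show ?thesis using assms(1) by (simp add: convergence_rate_def)
    next
      case 2
      have "(\<lambda>a::real. a) \<in> O[at_right 0](\<lambda>a. 1)"
        by (intro bigoI_tendsto[of _ _ 0]) (auto intro: tendsto_ident_at)
      with 2 assms(1) show ?thesis
        by (auto simp: convergence_rate_def intro: landau_o.small_big_trans)
    next
      case 3
      have "((\<lambda>a::real. a ^ 2) \<longlongrightarrow> 0 ^ 2) (at_right 0)" by (intro tendsto_intros)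
      then have "(\<lambda>a::real. a ^ 2) \<in> o[at_right 0](\<lambda>a. 1)" by (intro smalloI_tendsto) auto
      with 3 assms(1) show ?thesis
        by (auto simp: convergence_rate_def intro: landau_o.big_small_trans)
    qed
  qed
  then have "\<forall>\<^sub>F a in at_right 0. norm (\<omega> a) \<le> e * norm (1::real)"
    using assms(3) by (rule landau_o.smallD)
  then have "\<forall>\<^sub>F a in at_right 0. \<omega> a \<le> e \<and> 0 < a"
    using eventually_at_right_less by eventually_elim auto
  then show thesis using eventually_happens'[of "at_right (0::real)"] that by force
qed

text \<open>
  The supremum of the oscillation over pairs at distance at most \<open>a\<close>; it tends to \<open>0\<close> by uniform
  continuity on the compact interval.
\<close>

lemma modulus_of_continuity:
  fixes g :: "real \<Rightarrow> real"
  assumes g: "continuous_on {0..T} g" and T: "0 \<le> T"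
  obtains \<mu> where "mono \<mu>" "\<And>a. 0 \<le> a \<Longrightarrow> 0 \<le> \<mu> a" "(\<mu> \<longlongrightarrow> 0) (at_right 0)"
    "\<And>x y a. \<lbrakk>x \<in> {0..T}; y \<in> {0..T}; \<bar>x - y\<bar> \<le> a\<rbrakk> \<Longrightarrow> \<bar>g x - g y\<bar> \<le> \<mu> a"
proof -
  \<comment> \<open>The maximum with \<open>0\<close> keeps the set nonempty for negative \<open>a\<close>, so that \<open>\<mu>\<close> is monotone everywhere.\<close>
  define S where "S a = {(x, y). x \<in> {0..T} \<and> y \<in> {0..T} \<and> \<bar>x - y\<bar> \<le> max 0 a}" for a
  define \<mu> where "\<mu> a = (SUP (x, y)\<in>S a. \<bar>g x - g y\<bar>)" for a
  have "bounded (g ` {0..T})"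
    using g by (intro compact_imp_bounded compact_continuous_image) auto
  then obtain B where B: "\<And>x. x \<in> {0..T} \<Longrightarrow> \<bar>g x\<bar> \<le> B"
    unfolding bounded_iff by (metis imageI real_norm_def)
  have bdd: "bdd_above ((\<lambda>(x, y). \<bar>g x - g y\<bar>) ` S a)" for a
  proof (intro bdd_aboveI2[of _ _ "2 * B"])
    fix p assume "p \<in> S a"
    then obtain x y where p: "p = (x, y)" "x \<in> {0..T}" "y \<in> {0..T}" by (auto simp: S_def)
    show "(case p of (x, y) \<Rightarrow> \<bar>g x - g y\<bar>) \<le> 2 * B" using B[OF p(2)] B[OF p(3)] p(1) by simp
  qed
  have S0: "(0, 0) \<in> S a" for a using T by (simp add: S_def)
  have up: "\<bar>g x - g y\<bar> \<le> \<mu> a" if "(x, y) \<in> S a" for x y a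
    unfolding \<mu>_def using cSUP_upper[OF that bdd] by simp
  show thesis
  proof (rule that[of \<mu>])
    show "mono \<mu>"
    proof (rule monoI)
      fix a b :: real assume "a \<le> b"
      then have "S a \<subseteq> S b" by (auto simp: S_def)
      then show "\<mu> a \<le> \<mu> b" unfolding \<mu>_def using bdd S0 by (intro cSUP_subset_mono) auto
    qed
    show nn: "0 \<le> \<mu> a" for a using up[OF S0] by simp
    show "\<bar>g x - g y\<bar> \<le> \<mu> a" if "x \<in> {0..T}" "y \<in> {0..T}" "\<bar>x - y\<bar> \<le> a" for x y a
      using that by (intro up) (auto simp: S_def)
    show "(\<mu> \<longlongrightarrow> 0) (at_right 0)"
    proof (rule tendstoI)
      fix e :: real assume e: "0 < e"
      have "uniformly_continuous_on {0..T} g" using g by (intro compact_uniformly_continuous) auto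
      then obtain d where d: "0 < d"
        "\<And>x y. \<lbrakk>x \<in> {0..T}; y \<in> {0..T}; dist y x < d\<rbrakk> \<Longrightarrow> dist (g y) (g x) < e / 2"
        using e unfolding uniformly_continuous_on_def by (metis half_gt_zero)
      have "\<forall>\<^sub>F a in at_right 0. 0 < a \<and> a < d"
        using d(1) by (auto simp: eventually_at_right_field intro!: exI[of _ d])
      then show "\<forall>\<^sub>F a in at_right 0. dist (\<mu> a) 0 < e"
      proof eventually_elim
        case (elim a)
        have "\<mu> a \<le> e / 2" unfolding \<mu>_def
        proof (rule cSUP_least)
          show "S a \<noteq> {}" using S0 by auto
          fix p assume "p \<in> S a"
          then obtain x y where "p = (x, y)" "x \<in> {0..T}" "y \<in> {0..T}" "\<bar>x - y\<bar> < d"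
            using elim by (auto simp: S_def)
          then show "(case p of (x, y) \<Rightarrow> \<bar>g x - g y\<bar>) \<le> e / 2"
            using d(2)[of y x] by (simp add: dist_real_def)
        qed
        then show ?case using nn[of a] e by simp
      qed
    qed
  qed
qed

text \<open>
  The shape of the error for \<open>k < 2\<close>: the modulus of continuity comes from the difference quotient, the
  linear term from replacing the state at the midpoint by the mean of the two states.
\<close>

lemma convergence_rate_modulus:
  assumes "mono \<mu>" "\<And>a. 0 \<le> a \<Longrightarrow> 0 \<le> \<mu> a" "(\<mu> \<longlongrightarrow> 0) (at_right 0)" "0 < c" "k \<in> {0, 1}"
  shows "convergence_rate k (\<lambda>a. a ^ k * (\<mu> a + c * a))"
  unfolding convergence_rate_def
proof (intro conjI impI allI)
  show "mono_on {0<..} (\<lambda>a. a ^ k * (\<mu> a + c * a))"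
    using assms
    by (intro monotone_onI mult_mono add_mono power_mono mult_left_mono) (auto dest: monoD)
  show "0 < a ^ k * (\<mu> a + c * a)" if "0 < a" for a
    using assms that by (intro mult_pos_pos add_nonneg_pos) auto
  have "((\<lambda>a. \<mu> a + c * a) \<longlongrightarrow> 0 + c * 0) (at_right 0)" by (intro tendsto_intros assms)
  then have "(\<lambda>a. \<mu> a + c * a) \<in> o[at_right 0](\<lambda>a. 1)" by (intro smalloI_tendsto) auto
  then have "(\<lambda>a. a ^ k * (\<mu> a + c * a)) \<in> o[at_right 0](\<lambda>a. a ^ k * 1)"
    by (rule landau_o.small.mult_left)
  then show "(\<lambda>a. a ^ k * (\<mu> a + c * a)) \<in> o[at_right 0](\<lambda>a. a ^ k)" by simp
qed (use assms in auto)

lemma convergence_rate_square: "0 < c \<Longrightarrow> convergence_rate 2 (\<lambda>a. c * a ^ 2)"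
  unfolding convergence_rate_def
  by (auto intro!: monotone_onI mult_left_mono power_mono)

lemma symmetric_taylor:
  fixes d :: "nat \<Rightarrow> real \<Rightarrow> real"
  assumes der: "\<And>i x. \<lbrakk>i \<le> n; x \<in> {s - \<eta>..s + \<eta>}\<rbrakk> \<Longrightarrow>
      (d i has_real_derivative d (Suc i) x) (at x within {s - \<eta>..s + \<eta>})"
    and B: "\<And>x. x \<in> {s - \<eta>..s + \<eta>} \<Longrightarrow> \<bar>d (Suc n) x\<bar> \<le> B" and \<eta>: "0 \<le> \<eta>"
  shows "\<bar>d 0 (s + \<eta>) - (\<Sum>i\<le>n. d i s * \<eta> ^ i / fact i)\<bar> \<le> B * \<eta> ^ Suc n / fact n"
    and "\<bar>d 0 (s - \<eta>) - (\<Sum>i\<le>n. d i s * (- \<eta>) ^ i / fact i)\<bar> \<le> B * \<eta> ^ Suc n / fact n"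
  using field_Taylor[of "{s - \<eta>..s + \<eta>}" n d B s "s + \<eta>"]
    field_Taylor[of "{s - \<eta>..s + \<eta>}" n d B s "s - \<eta>"] assms by simp_all

text \<open>
  The first estimate is the error of the midpoint rule as a quadrature of \<open>g'\<close>, the second is the
  distance of \<open>g\<close> at the midpoint from the mean of its endpoint values, at which the scheme evaluates the
  right-hand side. Both follow from expanding \<open>g\<close> about the midpoint \<open>s\<close>; terms of even order cancel in
  the first, terms of odd order in the second. For \<open>k < 2\<close> the first estimate needs more than a bounded
  derivative of order \<open>k + 1\<close>: subtracting from \<open>g\<close> the Taylor term of that order makes the derivative as
  small as its modulus of continuity.
\<close>

lemma midpoint_consistency:
  assumes T: "0 < T" and k: "k \<in> {0, 1, 2}" and g: "C_class_on (k + 1) g {0..T}"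
  obtains \<omega> where "convergence_rate k \<omega>"
    "\<And>t t' g'. \<lbrakk>0 \<le> t; t < t'; t' \<le> T;
        (g has_real_derivative g') (at ((t + t') / 2) within {0..T})\<rbrakk> \<Longrightarrow>
      \<bar>g t' - g t - (t' - t) * g'\<bar> \<le> (t' - t) * \<omega> (t' - t) \<and>
      \<bar>g ((t + t') / 2) - (g t + g t') / 2\<bar> \<le> \<omega> (t' - t)"
proof -
  obtain D where D0: "\<And>t. t \<in> {0..T} \<Longrightarrow> D 0 t = g t"
    and D: "\<And>i t. i < Suc k \<Longrightarrow> t \<in> {0..T} \<Longrightarrow>
      (D i has_real_derivative D (Suc i) t) (at t within {0..T})"
    and cont: "continuous_on {0..T} (D (Suc k))"
    using g unfolding C_class_on_def Suc_eq_plus1 by metis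
  have contD: "continuous_on {0..T} (D i)" if "i \<le> Suc k" for i
  proof (cases "i = Suc k")
    case False
    then show ?thesis using D[of i] that by (intro DERIV_continuous_on) auto
  qed (use cont in simp)
  have "\<exists>B. \<forall>x\<in>{0..T}. \<bar>D i x\<bar> \<le> B" if "i \<le> Suc k" for i
    using compact_imp_bounded[OF compact_continuous_image[OF contD[OF that]]]
    by (auto simp: bounded_iff)
  then obtain b where b: "\<And>i x. i \<le> Suc k \<Longrightarrow> x \<in> {0..T} \<Longrightarrow> \<bar>D i x\<bar> \<le> b i" by metis
  define B where "B = (\<Sum>i\<le>Suc k. b i)"
  have b0: "0 \<le> b i" if "i \<le> Suc k" for i using b[OF that, of 0] T by simp
  have B: "\<bar>D i x\<bar> \<le> B" if "i \<le> Suc k" "x \<in> {0..T}" for i x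
    using b[OF that] member_le_sum[of i "{..Suc k}" b] b0 that by (simp add: B_def)
  have B0: "0 \<le> B" unfolding B_def using b0 by (intro sum_nonneg) auto
  obtain \<mu> where \<mu>: "mono \<mu>" "\<And>a. 0 \<le> a \<Longrightarrow> 0 \<le> \<mu> a" "(\<mu> \<longlongrightarrow> 0) (at_right 0)"
    "\<And>x y a. \<lbrakk>x \<in> {0..T}; y \<in> {0..T}; \<bar>x - y\<bar> \<le> a\<rbrakk> \<Longrightarrow> \<bar>D (Suc k) x - D (Suc k) y\<bar> \<le> \<mu> a"
    using modulus_of_continuity[OF cont] T by (metis less_imp_le)
  define \<omega> where "\<omega> a = (if k = 2 then (B + 1) * a ^ 2 else a ^ k * (\<mu> a + (B + 1) * a))" for a
  show thesis
  proof (rule that)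
    show "convergence_rate k \<omega>"
    proof (cases "k = 2")
      case True then show ?thesis
        using convergence_rate_square[of "B + 1"] B0 by (simp add: \<omega>_def[abs_def])
    next
      case False then show ?thesis
        using convergence_rate_modulus[OF \<mu>(1-3), of "B + 1" k] B0 k by (simp add: \<omega>_def[abs_def])
    qed
    fix t t' g' :: real
    assume t: "0 \<le> t" "t < t'" "t' \<le> T"
      and g': "(g has_real_derivative g') (at ((t + t') / 2) within {0..T})"
    define s \<eta> where "s = (t + t') / 2" and "\<eta> = (t' - t) / 2"
    have \<eta>: "0 < \<eta>" "t' - t = 2 * \<eta>" and st: "t = s - \<eta>" "t' = s + \<eta>"
      using t by (auto simp: s_def \<eta>_def field_simps)
    have S: "{s - \<eta>..s + \<eta>} \<subseteq> {0..T}" "s \<in> {0<..<T}" "s \<in> {0..T}"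
      using t \<eta>(1) unfolding st by auto
    \<comment> \<open>The midpoint is an interior point of the interval, where derivatives are unique.\<close>
    have "(g has_real_derivative D 1 s) (at s within {0..T})"
      using D[of 0 s] D0 S(3) has_field_derivative_transform_within[of "D 0" _ s "{0..T}" 1 g] by auto
    then have g'_eq: "g' = D 1 s"
      using g' S(2) at_within_Icc_at[of 0 s T] DERIV_unique by (simp add: s_def)
    have gD: "g (s + \<eta>) = D 0 (s + \<eta>)" "g (s - \<eta>) = D 0 (s - \<eta>)" "g s = D 0 s"
      using D0 t S by (auto simp: st)
    have D': "(D i has_real_derivative D (Suc i) x) (at x within {s - \<eta>..s + \<eta>})"
      if "i \<le> k" "x \<in> {s - \<eta>..s + \<eta>}" for i x
      using D[of i x] that S(1) by (intro DERIV_subset[OF _ S(1)]) auto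
    have B': "\<bar>D i x\<bar> \<le> B" if "i \<le> Suc k" "x \<in> {s - \<eta>..s + \<eta>}" for i x
      using B that S(1) by blast
    have taylor: "\<bar>D 0 (s + \<eta>) - (\<Sum>i\<le>n. D i s * \<eta> ^ i / fact i)\<bar> \<le> B * \<eta> ^ Suc n / fact n"
      "\<bar>D 0 (s - \<eta>) - (\<Sum>i\<le>n. D i s * (- \<eta>) ^ i / fact i)\<bar> \<le> B * \<eta> ^ Suc n / fact n"
      if "n \<le> k" for n
      by (rule symmetric_taylor; use that \<eta>(1) D' B' in simp)+
    have mod: "\<bar>D (Suc k) x - D (Suc k) s\<bar> \<le> \<mu> (2 * \<eta>)" if "x \<in> {s - \<eta>..s + \<eta>}" for x
      using that S \<eta>(1) by (intro \<mu>(4)) auto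
    have "\<bar>D 0 (s + \<eta>) - D 0 (s - \<eta>) - 2 * \<eta> * D 1 s\<bar> \<le> 2 * \<eta> * \<omega> (2 * \<eta>) \<and>
      \<bar>D 0 s - (D 0 (s - \<eta>) + D 0 (s + \<eta>)) / 2\<bar> \<le> \<omega> (2 * \<eta>)"
    proof -
      consider "k = 0" | "k = 1" | "k = 2" using k by auto
      then show ?thesis
      proof cases
        case 1
        have low: "\<bar>D 0 (s + \<eta>) - D 0 s\<bar> \<le> B * \<eta>" "\<bar>D 0 (s - \<eta>) - D 0 s\<bar> \<le> B * \<eta>"
          using taylor[of 0] 1 by simp_all
        define d where "d i x = (if i = 0 then D 0 x - D 1 s * (x - s) else D 1 x - D 1 s)"
          for i :: nat and x
        have "(d i has_real_derivative d (Suc i) x) (at x within {s - \<eta>..s + \<eta>})"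
          if "i \<le> 0" "x \<in> {s - \<eta>..s + \<eta>}" for i x
          using D'[of 0 x] that 1 unfolding d_def by (auto intro!: derivative_eq_intros)
        moreover have "\<bar>d (Suc 0) x\<bar> \<le> \<mu> (2 * \<eta>)" if "x \<in> {s - \<eta>..s + \<eta>}" for x
          using mod[OF that] 1 by (simp add: d_def)
        ultimately have high: "\<bar>d 0 (s + \<eta>) - d 0 s\<bar> \<le> \<mu> (2 * \<eta>) * \<eta>"
            "\<bar>d 0 (s - \<eta>) - d 0 s\<bar> \<le> \<mu> (2 * \<eta>) * \<eta>"
          using symmetric_taylor[of 0 s \<eta> d "\<mu> (2 * \<eta>)"] \<eta>(1) by simp_all
        have high': "\<bar>D 0 (s + \<eta>) - D 0 s - D 1 s * \<eta>\<bar> \<le> \<mu> (2 * \<eta>) * \<eta>"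
            "\<bar>D 0 (s - \<eta>) - D 0 s + D 1 s * \<eta>\<bar> \<le> \<mu> (2 * \<eta>) * \<eta>"
          using high by (simp_all add: d_def algebra_simps)
        have *: "0 \<le> B * \<eta>\<^sup>2" "0 \<le> \<eta>\<^sup>2" "0 \<le> B * \<eta>" "0 \<le> \<mu> (2 * \<eta>)"
          using B0 \<eta>(1) \<mu>(2) by auto
        have \<omega>: "\<omega> (2 * \<eta>) = \<mu> (2 * \<eta>) + 2 * (B * \<eta>) + 2 * \<eta>"
          "2 * \<eta> * \<omega> (2 * \<eta>) = 2 * (\<mu> (2 * \<eta>) * \<eta>) + 4 * (B * \<eta>\<^sup>2) + 4 * \<eta>\<^sup>2"
          "2 * \<eta> * D 1 s = 2 * (D 1 s * \<eta>)"
          using 1 by (simp_all add: \<omega>_def algebra_simps power2_eq_square)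
        show ?thesis unfolding \<omega>(2,3) unfolding \<omega>(1) abs_le_iff
          using low high' * \<eta>(1) unfolding abs_le_iff by argo
      next
        case 2
        have low: "\<bar>D 0 (s + \<eta>) - (D 0 s + D 1 s * \<eta>)\<bar> \<le> B * \<eta>\<^sup>2"
          "\<bar>D 0 (s - \<eta>) - (D 0 s - D 1 s * \<eta>)\<bar> \<le> B * \<eta>\<^sup>2"
          using taylor[of 1] 2 by (simp_all add: fact_numeral numeral_2_eq_2)
        define d where "d i x = (if i = 0 then D 0 x - D 2 s * (x - s)\<^sup>2 / 2 else
            if i = 1 then D 1 x - D 2 s * (x - s) else D 2 x - D 2 s)"
          for i :: nat and x
        have "(d i has_real_derivative d (Suc i) x) (at x within {s - \<eta>..s + \<eta>})"
          if "i \<le> 1" "x \<in> {s - \<eta>..s + \<eta>}" for i x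
          using D'[of 0 x] D'[of 1 x] that 2 unfolding d_def
          by (cases "i = 0") (auto intro!: derivative_eq_intros simp: numeral_2_eq_2)
        moreover have "\<bar>d (Suc 1) x\<bar> \<le> \<mu> (2 * \<eta>)" if "x \<in> {s - \<eta>..s + \<eta>}" for x
          using mod[OF that] 2 by (simp add: d_def numeral_2_eq_2)
        ultimately have high: "\<bar>d 0 (s + \<eta>) - (d 0 s + d 1 s * \<eta>)\<bar> \<le> \<mu> (2 * \<eta>) * \<eta>\<^sup>2"
            "\<bar>d 0 (s - \<eta>) - (d 0 s - d 1 s * \<eta>)\<bar> \<le> \<mu> (2 * \<eta>) * \<eta>\<^sup>2"
          using symmetric_taylor[of 1 s \<eta> d "\<mu> (2 * \<eta>)"] \<eta>(1) by (simp_all add: numeral_2_eq_2)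
        have *: "0 \<le> B * \<eta>\<^sup>2" "0 \<le> B * \<eta> ^ 3" "0 \<le> \<eta> ^ 3" "0 \<le> \<eta>\<^sup>2" "0 \<le> \<mu> (2 * \<eta>) * \<eta>"
          "0 \<le> \<mu> (2 * \<eta>) * \<eta>\<^sup>2" using B0 \<eta>(1) \<mu>(2) by auto
        have high': "\<bar>D 0 (s + \<eta>) - (D 0 s + D 1 s * \<eta> + D 2 s * \<eta>\<^sup>2 / 2)\<bar> \<le> \<mu> (2 * \<eta>) * \<eta>\<^sup>2"
            "\<bar>D 0 (s - \<eta>) - (D 0 s - D 1 s * \<eta> + D 2 s * \<eta>\<^sup>2 / 2)\<bar> \<le> \<mu> (2 * \<eta>) * \<eta>\<^sup>2"
          using high by (simp_all add: d_def algebra_simps)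
        have \<omega>: "\<omega> (2 * \<eta>) = 2 * (\<mu> (2 * \<eta>) * \<eta>) + 4 * (B * \<eta>\<^sup>2) + 4 * \<eta>\<^sup>2"
          "2 * \<eta> * \<omega> (2 * \<eta>) = 4 * (\<mu> (2 * \<eta>) * \<eta>\<^sup>2) + 8 * (B * \<eta> ^ 3) + 8 * \<eta> ^ 3"
          "2 * \<eta> * D 1 s = 2 * (D 1 s * \<eta>)"
          using 2 by (simp_all add: \<omega>_def algebra_simps power2_eq_square power3_eq_cube)
        show ?thesis unfolding \<omega>(2,3) unfolding \<omega>(1) abs_le_iff
          using low high' * unfolding abs_le_iff by argo
      next
        case 3
        have low: "\<bar>D 0 (s + \<eta>) - (D 0 s + D 1 s * \<eta>)\<bar> \<le> B * \<eta>\<^sup>2"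
          "\<bar>D 0 (s - \<eta>) - (D 0 s - D 1 s * \<eta>)\<bar> \<le> B * \<eta>\<^sup>2"
          using taylor[of 1] 3 by (simp_all add: fact_numeral numeral_2_eq_2)
        have high: "\<bar>D 0 (s + \<eta>) - (D 0 s + D 1 s * \<eta> + D 2 s * \<eta>\<^sup>2 / 2)\<bar> \<le> B * \<eta> ^ 3 / 2"
          "\<bar>D 0 (s - \<eta>) - (D 0 s - D 1 s * \<eta> + D 2 s * \<eta>\<^sup>2 / 2)\<bar> \<le> B * \<eta> ^ 3 / 2"
          using taylor[of 2] 3 by (simp_all add: fact_numeral numeral_2_eq_2 numeral_3_eq_3)
        have *: "0 \<le> B * \<eta>\<^sup>2" "0 \<le> B * \<eta> ^ 3" "0 \<le> \<eta> ^ 3" "0 \<le> \<eta>\<^sup>2" using B0 \<eta>(1) by auto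
        have \<omega>: "\<omega> (2 * \<eta>) = 4 * (B * \<eta>\<^sup>2) + 4 * \<eta>\<^sup>2"
          "2 * \<eta> * \<omega> (2 * \<eta>) = 8 * (B * \<eta> ^ 3) + 8 * \<eta> ^ 3"
          "2 * \<eta> * D 1 s = 2 * (D 1 s * \<eta>)"
          using 3 by (simp_all add: \<omega>_def algebra_simps power2_eq_square power3_eq_cube)
        show ?thesis unfolding \<omega>(2,3) unfolding \<omega>(1) abs_le_iff
          using low high * unfolding abs_le_iff by argo
      qed
    qed
    then show "\<bar>g t' - g t - (t' - t) * g'\<bar> \<le> (t' - t) * \<omega> (t' - t) \<and>
      \<bar>g ((t + t') / 2) - (g t + g t') / 2\<bar> \<le> \<omega> (t' - t)"
      unfolding s_def[symmetric] \<eta>(2) g'_eq st(1)[symmetric] st(2)[symmetric]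
      using gD by (simp add: st)
  qed
qed

section \<open>Convergence of the implicit midpoint rule in a Banach space\<close>

lemma midpoint_eq_add: "midpoint x y = x + (1 / 2) *\<^sub>R (y - x)"
  by (simp add: midpoint_def algebra_simps flip: scaleR_add_left)

text \<open>
  In terms of the midpoint \<open>u\<close> of \<open>x\<close> and \<open>y\<close> the equation reads \<open>u = x + (\<tau> / 2) f u\<close>, whose right-hand side
  is a contraction of \<open>cball x \<rho>\<close>.
\<close>

lemma implicit_midpoint_step:
  fixes f :: "'a::banach \<Rightarrow> 'a"
  assumes "0 \<le> \<tau>" "0 \<le> \<rho>" "0 \<le> L"
    and bound: "\<And>u. u \<in> cball x \<rho> \<Longrightarrow> norm (f u) \<le> B"
    and lip: "\<And>u v. \<lbrakk>u \<in> cball x \<rho>; v \<in> cball x \<rho>\<rbrakk> \<Longrightarrow> norm (f u - f v) \<le> L * norm (u - v)"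
    and small: "\<tau> / 2 * B \<le> \<rho>" "\<tau> / 2 * L < 1"
  shows "\<exists>!y. y = x + \<tau> *\<^sub>R f (midpoint x y) \<and> norm (y - x) \<le> 2 * \<rho>"
proof -
  have "\<exists>!u. u \<in> cball x \<rho> \<and> x + (\<tau> / 2) *\<^sub>R f u = u"
  proof (rule Banach_fix)
    show "complete (cball x \<rho>)" "cball x \<rho> \<noteq> {}" using assms(2) by (auto simp: complete_eq_closed)
    show "0 \<le> \<tau> / 2 * L" using assms by simp
    show "(\<lambda>u. x + (\<tau> / 2) *\<^sub>R f u) ` cball x \<rho> \<subseteq> cball x \<rho>"
    proof clarify
      fix u assume "u \<in> cball x \<rho>"
      then have "\<tau> / 2 * norm (f u) \<le> \<tau> / 2 * B" using assms(1) by (intro mult_left_mono bound) auto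
      then show "x + (\<tau> / 2) *\<^sub>R f u \<in> cball x \<rho>"
        using small(1) assms(1) by (simp add: dist_norm)
    qed
    fix u v assume "u \<in> cball x \<rho>" "v \<in> cball x \<rho>"
    then have "\<tau> / 2 * norm (f u - f v) \<le> \<tau> / 2 * (L * norm (u - v))"
      using assms(1) by (intro mult_left_mono lip) auto
    then show "dist (x + (\<tau> / 2) *\<^sub>R f u) (x + (\<tau> / 2) *\<^sub>R f v) \<le> \<tau> / 2 * L * dist u v"
      using assms(1) by (simp add: dist_norm flip: scaleR_diff_right)
  qed (use small in auto)
  then obtain u where u: "u \<in> cball x \<rho>" "x + (\<tau> / 2) *\<^sub>R f u = u"
    and uniq: "\<And>v. v \<in> cball x \<rho> \<Longrightarrow> x + (\<tau> / 2) *\<^sub>R f v = v \<Longrightarrow> v = u" by metis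
  show ?thesis
  proof (rule ex1I)
    have "midpoint x (x + \<tau> *\<^sub>R f u) = u"
      using u(2) by (simp add: midpoint_eq_add)
    moreover have "norm (\<tau> *\<^sub>R f u) \<le> 2 * \<rho>"
      using mult_left_mono[OF bound[OF u(1)], of "\<tau> / 2"] small(1) assms(1) by simp
    ultimately show "x + \<tau> *\<^sub>R f u = x + \<tau> *\<^sub>R f (midpoint x (x + \<tau> *\<^sub>R f u)) \<and>
        norm (x + \<tau> *\<^sub>R f u - x) \<le> 2 * \<rho>" by simp
    fix y assume y: "y = x + \<tau> *\<^sub>R f (midpoint x y) \<and> norm (y - x) \<le> 2 * \<rho>"
    have d: "y - x = \<tau> *\<^sub>R f (midpoint x y)" using y by (simp add: algebra_simps)
    have "midpoint x y = x + (1 / 2) *\<^sub>R (\<tau> *\<^sub>R f (midpoint x y))"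
      by (subst d[symmetric]) (rule midpoint_eq_add)
    then have "midpoint x y = x + (\<tau> / 2) *\<^sub>R f (midpoint x y)" by simp
    moreover have "midpoint x y \<in> cball x \<rho>" using y by (simp add: dist_midpoint dist_commute flip: dist_norm)
    ultimately have "midpoint x y = u" using uniq by simp
    then show "y = x + \<tau> *\<^sub>R f u" using y by simp
  qed
qed

text \<open>
  With \<open>z = L \<tau> / 2\<close> this resolves the implicit error recursion: the factor \<open>(1 + z) / (1 - z)\<close> is at most
  \<open>exp (4 z)\<close> for \<open>z \<le> 1 / 2\<close>.
\<close>

lemma midpoint_amplification:
  fixes e e' z c :: real
  assumes "0 \<le> z" "z \<le> 1 / 2" "0 \<le> e" "0 \<le> c" "e' \<le> e + z * (e + e') + c"
  shows "e' \<le> exp (4 * z) * e + 2 * c"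
proof -
  have pos: "0 < 1 - z" using assms by simp
  have inv: "1 / (1 - z) \<le> 1 + 2 * z"
  proof -
    have "1 \<le> (1 + 2 * z) * (1 - z)" using assms mult_left_mono[of z "1 / 2" z] by (simp add: algebra_simps)
    then show ?thesis using pos by (simp add: field_simps)
  qed
  have "e' * (1 - z) \<le> (1 + z) * e + c" using assms(5) by (simp add: algebra_simps)
  then have "e' \<le> ((1 + z) * e + c) * (1 / (1 - z))" using pos by (simp add: field_simps)
  also have "\<dots> = (1 + z) * (1 / (1 - z)) * e + 1 / (1 - z) * c" by (simp add: algebra_simps)
  also have "\<dots> \<le> exp z * exp (2 * z) * e + 2 * c"
  proof (intro add_mono mult_right_mono mult_mono)
    show "1 / (1 - z) \<le> exp (2 * z)" using inv exp_ge_add_one_self[of "2 * z"] by linarith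
    show "1 / (1 - z) \<le> 2" using inv assms by linarith
  qed (use assms pos in auto)
  also have "exp z * exp (2 * z) * e \<le> exp (4 * z) * e"
    using assms by (intro mult_right_mono) (auto simp flip: exp_add)
  finally show ?thesis by simp
qed

text \<open>
  The bound \<open>E\<close> on the error is carried along the induction together with the existence of the step:
  the smallness condition keeps the error below \<open>r / 2\<close>, which leaves room in the tube for a ball of
  radius \<open>r / 2\<close> around the current value in which the midpoint is sought. The last conjunct says that the
  step has exactly one solution at distance at most \<open>r\<close>.
\<close>

theorem implicit_midpoint_convergence:
  fixes h :: "real \<Rightarrow> 'a::banach" and f :: "'a \<Rightarrow> real \<Rightarrow> 'a" and r T :: real
  defines "U \<equiv> {x. \<exists>t\<in>{0..T}. dist (h t) x \<le> r}"
  assumes pos: "0 \<le> r" "0 \<le> L" "0 \<le> \<epsilon>"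
    and bound: "\<And>x s. \<lbrakk>x \<in> U; s \<in> {0..T}\<rbrakk> \<Longrightarrow> norm (f x s) \<le> B"
    and lip: "\<And>x y s. \<lbrakk>x \<in> U; y \<in> U; s \<in> {0..T}\<rbrakk> \<Longrightarrow> norm (f x s - f y s) \<le> L * norm (x - y)"
    and cons: "\<And>t t'. \<lbrakk>0 \<le> t; t < t'; t' \<le> T; t' - t \<le> a\<rbrakk> \<Longrightarrow> midpoint (h t) (h t') \<in> U \<and>
      norm (h t' - h t - (t' - t) *\<^sub>R f (midpoint (h t) (h t')) ((t + t') / 2)) \<le> (t' - t) * \<epsilon>"
    and a: "a * B \<le> r" "a * L \<le> 1" "0 \<le> B"
    and t: "t 0 = 0" "\<And>m. m < M \<Longrightarrow> t m < t (Suc m)" "t M \<le> T"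
      "\<And>m. m < M \<Longrightarrow> t (Suc m) - t m \<le> a"
    and small: "exp (2 * L * T) * (norm (h 0 - x0) + 2 * T * \<epsilon>) \<le> r / 2"
  shows "\<exists>x. x 0 = x0 \<and>
    (\<forall>m\<le>M. norm (h (t m) - x m) \<le> exp (2 * L * T) * (norm (h 0 - x0) + 2 * T * \<epsilon>)) \<and>
    (\<forall>m<M. \<forall>y. (y = x m + (t (Suc m) - t m) *\<^sub>R f (midpoint (x m) y) ((t m + t (Suc m)) / 2) \<and>
        norm (y - x m) \<le> r) \<longleftrightarrow> y = x (Suc m))"
proof -
  define step where "step m x y \<longleftrightarrow>
    y = x + (t (Suc m) - t m) *\<^sub>R f (midpoint x y) ((t m + t (Suc m)) / 2) \<and> norm (y - x) \<le> r"
    for m x y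
  define E where "E s = exp (2 * L * s) * (norm (h 0 - x0) + 2 * s * \<epsilon>)" for s
  have grid: "0 \<le> t m \<and> t m \<le> T" if "m \<le> M" for m
  proof -
    have "t i \<le> t j" if "i \<le> j" "j \<le> M" for i j
      using that
    proof (induction j rule: dec_induct)
      case (step n) then show ?case using t(2)[of n] by simp
    qed simp
    from this[of 0 m] this[of m M] show ?thesis using t that by simp
  qed
  have E_le: "E s \<le> E T" if "0 \<le> s" "s \<le> T" for s
    unfolding E_def using that pos by (intro mult_mono add_mono) (auto intro: mult_left_mono)
  have ball_U: "cball x (r / 2) \<subseteq> U" if "m \<le> M" "norm (h (t m) - x) \<le> r / 2" for m x
  proof
    fix u assume "u \<in> cball x (r / 2)"
    then have "dist (h (t m)) u \<le> r"
      using dist_triangle[of "h (t m)" u x] that(2) by (simp add: dist_norm)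
    then show "u \<in> U" unfolding U_def using grid[OF that(1)] by auto
  qed
  have step_ex1: "\<exists>!y. step m x y" if m: "m < M" and x: "norm (h (t m) - x) \<le> r / 2" for m x
  proof -
    let ?\<tau> = "t (Suc m) - t m"
    have \<tau>: "0 < ?\<tau>" "?\<tau> \<le> a" using t m by auto
    have s: "(t m + t (Suc m)) / 2 \<in> {0..T}" using grid[of m] grid[of "Suc m"] m by auto
    have "\<exists>!y. y = x + ?\<tau> *\<^sub>R f (midpoint x y) ((t m + t (Suc m)) / 2) \<and> norm (y - x) \<le> 2 * (r / 2)"
    proof (rule implicit_midpoint_step)
      have "?\<tau> * B \<le> a * B" "?\<tau> * L \<le> a * L" using \<tau> a pos by (auto intro: mult_right_mono)
      then show "?\<tau> / 2 * B \<le> r / 2" "?\<tau> / 2 * L < 1" using a by auto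
    qed (use \<tau> pos s bound lip ball_U[of m x] m x in \<open>auto simp: subset_iff\<close>)
    then show ?thesis by (simp add: step_def)
  qed
  have step_error: "norm (h (t (Suc m)) - y) \<le> E (t (Suc m))"
    if m: "m < M" and x: "norm (h (t m) - x) \<le> E (t m)" "norm (h (t m) - x) \<le> r / 2" and y: "step m x y"
    for m x y
  proof -
    define \<tau> where "\<tau> = t (Suc m) - t m"
    define s where "s = (t m + t (Suc m)) / 2"
    define e e' where "e = norm (h (t m) - x)" and "e' = norm (h (t (Suc m)) - y)"
    define u u' where "u = midpoint x y" and "u' = midpoint (h (t m)) (h (t (Suc m)))"
    have \<tau>: "0 < \<tau>" "\<tau> \<le> a" using t m by (auto simp: \<tau>_def)
    have s: "s \<in> {0..T}" using grid[of m] grid[of "Suc m"] m by (auto simp: s_def)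
    have u': "u' \<in> U" "norm (h (t (Suc m)) - h (t m) - \<tau> *\<^sub>R f u' s) \<le> \<tau> * \<epsilon>"
      using cons[of "t m" "t (Suc m)"] grid[of m] grid[of "Suc m"] m \<tau>
      by (auto simp: u'_def s_def \<tau>_def)
    have "u \<in> cball x (r / 2)"
      using y by (simp add: step_def u_def dist_midpoint dist_commute flip: dist_norm)
    then have u: "u \<in> U" using ball_U[of m x] m x by auto
    have "u' - u = (1 / 2) *\<^sub>R ((h (t m) - x) + (h (t (Suc m)) - y))"
      by (simp add: u_def u'_def midpoint_def algebra_simps)
    then have uu: "norm (u' - u) \<le> (e + e') / 2"
      using norm_triangle_ineq[of "h (t m) - x" "h (t (Suc m)) - y"] by (simp add: e_def e'_def)
    have "y = x + \<tau> *\<^sub>R f u s" using y by (simp add: step_def \<tau>_def s_def u_def)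
    then have eq: "h (t (Suc m)) - y = (h (t m) - x) + \<tau> *\<^sub>R (f u' s - f u s)
        + (h (t (Suc m)) - h (t m) - \<tau> *\<^sub>R f u' s)"
      by (simp add: algebra_simps)
    have "e' \<le> norm ((h (t m) - x) + \<tau> *\<^sub>R (f u' s - f u s)) + \<tau> * \<epsilon>"
      using norm_triangle_ineq[of "(h (t m) - x) + \<tau> *\<^sub>R (f u' s - f u s)"
        "h (t (Suc m)) - h (t m) - \<tau> *\<^sub>R f u' s"] u'(2)
      unfolding e'_def eq by linarith
    also have "\<dots> \<le> e + \<tau> * norm (f u' s - f u s) + \<tau> * \<epsilon>"
      using norm_triangle_ineq[of "h (t m) - x" "\<tau> *\<^sub>R (f u' s - f u s)"] \<tau>(1) by (simp add: e_def)
    also have "\<tau> * norm (f u' s - f u s) \<le> \<tau> * (L * ((e + e') / 2))"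
      using \<tau>(1) pos(2) uu by (intro mult_left_mono order_trans[OF lip[OF u'(1) u s]]) auto
    finally have "e' \<le> e + \<tau> * L / 2 * (e + e') + \<tau> * \<epsilon>" by simp
    moreover have "\<tau> * L \<le> a * L" using \<tau> pos by (intro mult_right_mono) auto
    ultimately have "e' \<le> exp (4 * (\<tau> * L / 2)) * e + 2 * (\<tau> * \<epsilon>)"
      using \<tau>(1) pos a by (intro midpoint_amplification) (auto simp: e_def)
    also have "\<dots> \<le> exp (2 * L * \<tau>) * E (t m) + exp (2 * L * t (Suc m)) * (2 * (\<tau> * \<epsilon>))"
    proof (rule add_mono)
      show "exp (4 * (\<tau> * L / 2)) * e \<le> exp (2 * L * \<tau>) * E (t m)"
        using x(1) by (simp add: e_def mult_ac)
      have "1 \<le> exp (2 * L * t (Suc m))" using pos grid[of "Suc m"] m by simp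
      then show "2 * (\<tau> * \<epsilon>) \<le> exp (2 * L * t (Suc m)) * (2 * (\<tau> * \<epsilon>))"
        using \<tau> pos mult_right_mono[of 1 _ "2 * (\<tau> * \<epsilon>)"] by simp
    qed
    also have "exp (2 * L * \<tau>) * E (t m) = exp (2 * L * t (Suc m)) * (norm (h 0 - x0) + 2 * t m * \<epsilon>)"
    proof -
      have "2 * L * \<tau> + 2 * L * t m = 2 * L * t (Suc m)" by (simp add: \<tau>_def algebra_simps)
      then have "exp (2 * L * \<tau>) * exp (2 * L * t m) = exp (2 * L * t (Suc m))"
        by (metis exp_add)
      then show ?thesis by (simp only: E_def mult.assoc[symmetric])
    qed
    also have "\<dots> + exp (2 * L * t (Suc m)) * (2 * (\<tau> * \<epsilon>)) = E (t (Suc m))"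
      by (simp add: E_def \<tau>_def algebra_simps)
    finally show ?thesis by (simp add: e'_def)
  qed
  have close: "norm (h (t m) - x) \<le> r / 2" if "m \<le> M" "norm (h (t m) - x) \<le> E (t m)" for m x
    using that E_le[of "t m"] grid[of m] small by (simp add: E_def)
  have "\<exists>x. \<forall>m. ((m = 0 \<longrightarrow> x m = x0) \<and> (m \<le> M \<longrightarrow> norm (h (t m) - x m) \<le> E (t m))) \<and>
      (m < M \<longrightarrow> step m (x m) (x (Suc m)))"
  proof (rule dependent_nat_choice)
    show "\<exists>x. (0 = 0 \<longrightarrow> x = x0) \<and> (0 \<le> M \<longrightarrow> norm (h (t 0) - x) \<le> E (t 0))"
      by (auto simp: E_def t(1))
    fix x m assume x: "(m = 0 \<longrightarrow> x = x0) \<and> (m \<le> M \<longrightarrow> norm (h (t m) - x) \<le> E (t m))"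
    show "\<exists>y. ((Suc m = 0 \<longrightarrow> y = x0) \<and> (Suc m \<le> M \<longrightarrow> norm (h (t (Suc m)) - y) \<le> E (t (Suc m)))) \<and>
        (m < M \<longrightarrow> step m x y)"
    proof (cases "m < M")
      case True
      with x have "norm (h (t m) - x) \<le> r / 2" by (intro close) auto
      with step_ex1[OF True] obtain y where "step m x y" by blast
      with step_error[OF True] x True close[of m x] show ?thesis by auto
    qed auto
  qed
  then obtain x where x: "x 0 = x0" "\<And>m. m \<le> M \<Longrightarrow> norm (h (t m) - x m) \<le> E (t m)"
    "\<And>m. m < M \<Longrightarrow> step m (x m) (x (Suc m))" by blast
  show ?thesis
  proof (intro exI[of _ x] conjI allI impI)
    show "norm (h (t m) - x m) \<le> exp (2 * L * T) * (norm (h 0 - x0) + 2 * T * \<epsilon>)" if "m \<le> M" for m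
      using x(2)[OF that] E_le[of "t m"] grid[OF that] by (simp add: E_def)
    show "(y = x m + (t (Suc m) - t m) *\<^sub>R f (midpoint (x m) y) ((t m + t (Suc m)) / 2) \<and>
        norm (y - x m) \<le> r) \<longleftrightarrow> y = x (Suc m)" if m: "m < M" for m y
    proof -
      have "\<exists>!y. step m (x m) y" using m by (intro step_ex1 close x) auto
      then show ?thesis using x(3)[OF m] unfolding step_def by blast
    qed
  qed (rule x(1))
qed

section \<open>Height vectors as elements of a Banach space\<close>

text \<open>
  Height vectors are regarded as bounded sequences that vanish from the index \<open>N\<close> on. The supremum norm
  is then the maximum norm of \<open>\<real>\<^sup>N\<close>, and one Banach space serves every \<open>N\<close>; as the length of the list \<open>\<nu>\<close>, \<open>N\<close> cannot be
  the dimension of a type. The completeness of spaces of bounded continuous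
  functions is an instance for metric domains; hence the usual metric on the natural numbers, whose
  topology is the discrete one.
\<close>

instantiation nat :: metric_space
begin

definition dist_nat :: "nat \<Rightarrow> nat \<Rightarrow> real" where
  "dist_nat m n = \<bar>real m - real n\<bar>"

definition uniformity_nat :: "(nat \<times> nat) filter" where
  "uniformity_nat = (INF e\<in>{0<..}. principal {(m, n). dist m n < e})"

instance
proof
  fix U :: "nat set"
  have "m = n" if "\<bar>real m - real n\<bar> < 1" for m n using that by linarith
  then show "open U \<longleftrightarrow> (\<forall>n\<in>U. \<forall>\<^sub>F (m, k) in uniformity. m = n \<longrightarrow> k \<in> U)"
    by (fastforce simp: open_discrete uniformity_nat_def dist_nat_def eventually_principal
        intro!: eventually_INF1[of 1])
qed (auto simp: dist_nat_def uniformity_nat_def)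

end

instance bcontfun :: (metric_space, banach) banach ..

definition coord_vec :: "nat \<Rightarrow> (nat \<Rightarrow> real) \<Rightarrow> nat \<Rightarrow>\<^sub>C real" where
  "coord_vec N x = Bcontfun (\<lambda>j. if j < N then x j else 0)"

lemma coord_vec_apply: "apply_bcontfun (coord_vec N x) j = (if j < N then x j else 0)"
proof -
  have "(\<lambda>j. if j < N then x j else 0) \<in> bcontfun"
  proof (rule bcontfun_normI)
    show "norm (if j < N then x j else 0) \<le> (\<Sum>i<N. \<bar>x i\<bar>)" for j
      using member_le_sum[of j "{..<N}" "\<lambda>i. \<bar>x i\<bar>"] by (auto intro: sum_nonneg)
  qed (simp add: continuous_on_open_vimage open_discrete)
  then show ?thesis by (simp add: coord_vec_def Bcontfun_inverse)
qed

lemma norm_coord_vec_le: "norm (coord_vec N x) \<le> c \<longleftrightarrow> 0 \<le> c \<and> (\<forall>j<N. \<bar>x j\<bar> \<le> c)"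
proof
  assume c: "norm (coord_vec N x) \<le> c"
  have "\<bar>x j\<bar> \<le> c" if "j < N" for j
    using norm_bounded[of "coord_vec N x" j] c that by (simp add: coord_vec_apply)
  then show "0 \<le> c \<and> (\<forall>j<N. \<bar>x j\<bar> \<le> c)" using c norm_ge_zero order_trans by blast
next
  assume "0 \<le> c \<and> (\<forall>j<N. \<bar>x j\<bar> \<le> c)"
  then show "norm (coord_vec N x) \<le> c" by (intro norm_bound) (auto simp: coord_vec_apply)
qed

lemma norm_coord_vec:
  assumes "0 < N"
  shows "norm (coord_vec N x) = max_norm N x"
proof -
  have le: "max_norm N x \<le> c \<longleftrightarrow> (\<forall>j<N. \<bar>x j\<bar> \<le> c)" for c
    unfolding max_norm_def using assms by (subst Max_le_iff) auto
  have "norm (coord_vec N x) \<le> c \<longleftrightarrow> max_norm N x \<le> c" for c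
    unfolding norm_coord_vec_le le using assms by force
  then show ?thesis by (meson order.antisym order.refl)
qed

lemma coord_vec_diff: "coord_vec N x - coord_vec N y = coord_vec N (\<lambda>j. x j - y j)"
  and coord_vec_scaleR: "c *\<^sub>R coord_vec N x = coord_vec N (\<lambda>j. c * x j)"
  by (rule bcontfun_eqI; simp add: coord_vec_apply)+

lemma coord_vec_cong: "(\<And>j. j < N \<Longrightarrow> x j = y j) \<Longrightarrow> coord_vec N x = coord_vec N y"
  by (rule bcontfun_eqI) (simp add: coord_vec_apply)

text \<open>
  Continuity of \<open>coord_vec N\<close> in the coordinates is read off from this finite sum.
\<close>

lemma coord_vec_basis: "coord_vec N x = (\<Sum>i<N. x i *\<^sub>R coord_vec N (\<lambda>j. if j = i then 1 else 0))"
proof (rule bcontfun_eqI)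
  have "apply_bcontfun (\<Sum>i\<in>I. g i) j = (\<Sum>i\<in>I. apply_bcontfun (g i) j)"
    for I :: "nat set" and g :: "nat \<Rightarrow> nat \<Rightarrow>\<^sub>C real" and j
    by (induction I rule: infinite_finite_induct) auto
  then show "apply_bcontfun (coord_vec N x) j =
      apply_bcontfun (\<Sum>i<N. x i *\<^sub>R coord_vec N (\<lambda>j. if j = i then 1 else 0)) j" for j
    by (simp add: coord_vec_apply sum.delta if_distrib[of "\<lambda>a. _ * a"] cong: if_cong)
qed

lemma continuous_on_coord_vec:
  assumes "\<And>j. j < N \<Longrightarrow> continuous_on S (\<lambda>t. x t j)"
  shows "continuous_on S (\<lambda>t. coord_vec N (x t))"
  by (subst coord_vec_basis) (intro continuous_intros assms, auto)

text \<open>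
  Closed balls of bounded sequences are not compact; those of the first \<open>N\<close> coordinates are.
\<close>

lemma compact_coord_box:
  assumes "0 \<le> r"
  shows "compact {coord_vec N x | x. \<forall>j<N. \<bar>x j\<bar> \<le> r}"
proof -
  have "compactin (product_topology (\<lambda>_::nat. euclidean) UNIV) (PiE UNIV (\<lambda>_. {-r..r}))"
    by (simp add: compactin_PiE)
  then have "compact (PiE UNIV (\<lambda>_::nat. {-r..r}))"
    by (simp add: euclidean_product_topology)
  then have "compact (coord_vec N ` PiE UNIV (\<lambda>_. {-r..r}))"
    by (intro compact_continuous_image continuous_on_coord_vec)
      (auto intro: continuous_on_subset[OF continuous_on_product_coordinates])
  also have "coord_vec N ` PiE UNIV (\<lambda>_. {-r..r}) = {coord_vec N x | x. \<forall>j<N. \<bar>x j\<bar> \<le> r}"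
  proof safe
    fix x assume "\<forall>j<N. \<bar>x j\<bar> \<le> r"
    then have "(\<lambda>j. if j < N then x j else 0) \<in> PiE UNIV (\<lambda>_. {-r..r})"
      using assms by (auto simp: abs_le_iff minus_le_iff)
    moreover have "coord_vec N x = coord_vec N (\<lambda>j. if j < N then x j else 0)" by (rule coord_vec_cong) simp
    ultimately show "coord_vec N x \<in> coord_vec N ` PiE UNIV (\<lambda>_. {-r..r})" by blast
  next
    fix x :: "nat \<Rightarrow> real" assume "x \<in> PiE UNIV (\<lambda>_. {-r..r})"
    then have "\<forall>j<N. \<bar>x j\<bar> \<le> r" by (auto simp: abs_le_iff PiE_iff minus_le_iff)
    then show "\<exists>y. coord_vec N x = coord_vec N y \<and> (\<forall>j<N. \<bar>y j\<bar> \<le> r)" by blast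
  qed
  finally show ?thesis .
qed

context
  fixes \<nu> :: "complex list" and \<O> :: "complex list set"
  assumes \<nu>: "\<nu> \<noteq> []" and \<O>: "\<O> \<subseteq> polygon_class \<nu>" "openin (polygon_topology \<nu>) \<O>"
begin

interpretation PC: Metric_space "polygon_class \<nu>" "polygon_dist \<nu>"
  using \<nu> by (rule Metric_space_polygon_class)

lemma polygon_dist_le: "polygon_dist \<nu> w v \<le> c \<longleftrightarrow> (\<forall>j<length \<nu>. \<bar>height \<nu> w j - height \<nu> v j\<bar> \<le> c)"
  unfolding polygon_dist_def max_norm_def using \<nu> by (subst Max_le_iff) auto

lemma polygon_dist_vec:
  "polygon_dist \<nu> w v = norm (coord_vec (length \<nu>) (height \<nu> w) - coord_vec (length \<nu>) (height \<nu> v))"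
  using \<nu> by (simp add: polygon_dist_def coord_vec_diff norm_coord_vec)

lemma polygon_eqI:
  assumes "w \<in> polygon_class \<nu>" "v \<in> polygon_class \<nu>"
    and "\<And>j. j < length \<nu> \<Longrightarrow> height \<nu> w j = height \<nu> v j"
  shows "w = v"
proof -
  have "polygon_dist \<nu> w v \<le> 0" using assms(3) by (simp add: polygon_dist_le)
  then show ?thesis using PC.zero[OF assms(1,2)] PC.nonneg[of w v] by simp
qed

text \<open>
  Coordinates from \<open>length \<nu>\<close> on are left free, so that this set is open in the space of all bounded
  sequences.
\<close>

definition realised :: "(nat \<Rightarrow>\<^sub>C real) set" where
  "realised = {x. \<exists>v\<in>\<O>. \<forall>j<length \<nu>. height \<nu> v j = apply_bcontfun x j}"

definition realisation :: "(nat \<Rightarrow>\<^sub>C real) \<Rightarrow> complex list" where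
  "realisation x = (SOME v. v \<in> \<O> \<and> (\<forall>j<length \<nu>. height \<nu> v j = apply_bcontfun x j))"

lemma realisation:
  assumes "x \<in> realised"
  shows "realisation x \<in> \<O>" "j < length \<nu> \<Longrightarrow> height \<nu> (realisation x) j = apply_bcontfun x j"
proof -
  obtain v where "v \<in> \<O> \<and> (\<forall>j<length \<nu>. height \<nu> v j = apply_bcontfun x j)"
    using assms unfolding realised_def by blast
  then have "realisation x \<in> \<O> \<and> (\<forall>j<length \<nu>. height \<nu> (realisation x) j = apply_bcontfun x j)"
    unfolding realisation_def by (rule someI)
  then show "realisation x \<in> \<O>"
    "j < length \<nu> \<Longrightarrow> height \<nu> (realisation x) j = apply_bcontfun x j" by auto
qed

lemma realisation_eqI:
  assumes "v \<in> \<O>" "\<And>j. j < length \<nu> \<Longrightarrow> height \<nu> v j = apply_bcontfun x j"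
  shows "x \<in> realised" "realisation x = v"
proof -
  show x: "x \<in> realised" using assms by (auto simp: realised_def)
  show "realisation x = v"
    using realisation[OF x] assms \<O>(1) by (intro polygon_eqI) auto
qed

lemma realisation_vec:
  assumes "v \<in> \<O>"
  shows "coord_vec (length \<nu>) (height \<nu> v) \<in> realised" "realisation (coord_vec (length \<nu>) (height \<nu> v)) = v"
  using assms realisation_eqI[of v "coord_vec (length \<nu>) (height \<nu> v)"] by (auto simp: coord_vec_apply)

lemma polygon_dist_realisation:
  assumes "x \<in> realised" "y \<in> realised"
  shows "polygon_dist \<nu> (realisation x) (realisation y) \<le> norm (x - y)"
  unfolding polygon_dist_le
  using realisation(2)[OF assms(1)] realisation(2)[OF assms(2)] norm_bounded[of "x - y"] by simp

lemma open_realised: "open realised"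
proof (rule openI)
  fix x assume x: "x \<in> realised"
  let ?v = "realisation x"
  have v: "?v \<in> \<O>" "?v \<in> polygon_class \<nu>" using realisation[OF x] \<O>(1) by auto
  obtain r where r: "0 < r" "PC.mball ?v r \<subseteq> \<O>"
    using \<O>(2) v(1) unfolding polygon_topology_def PC.openin_mtopology by blast
  obtain \<eta> where \<eta>: "0 < \<eta>" "\<And>y. (\<And>j. j < length \<nu> \<Longrightarrow> \<bar>y j - height \<nu> ?v j\<bar> \<le> \<eta>) \<Longrightarrow>
    \<exists>u\<in>polygon_class \<nu>. \<forall>j<length \<nu>. height \<nu> u j = y j"
    using polygon_class_heights_open[OF v(2)] by metis
  have "y \<in> realised" if "dist x y < min \<eta> (r / 2)" for y
  proof -
    have d: "\<bar>apply_bcontfun x j - apply_bcontfun y j\<bar> \<le> min \<eta> (r / 2)" for j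
      using norm_bounded[of "x - y" j] that by (simp add: dist_norm)
    obtain u where u: "u \<in> polygon_class \<nu>" "\<And>j. j < length \<nu> \<Longrightarrow> height \<nu> u j = apply_bcontfun y j"
      using \<eta>(2)[of "apply_bcontfun y"] d realisation(2)[OF x] by (auto simp: abs_minus_commute)
    have "polygon_dist \<nu> ?v u \<le> r / 2"
      unfolding polygon_dist_le using d u(2) realisation(2)[OF x] by simp
    then have "u \<in> \<O>" using r u(1) v(2) by (auto simp: PC.mball_def)
    then show ?thesis using u(2) by (intro realisation_eqI)
  qed
  then show "\<exists>e>0. ball x e \<subseteq> realised"
    using \<eta>(1) r(1) by (intro exI[of _ "min \<eta> (r / 2)"]) auto
qed

text \<open>
  The map is nonexpanding, because the distance of polygons is that of their heights.
\<close>

lemma continuous_map_realisation: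
  "continuous_map (top_of_set realised) (polygon_topology \<nu>) realisation"
  unfolding polygon_topology_def PC.continuous_map_to_metric
proof (intro ballI allI impI)
  fix x and e :: real assume "x \<in> topspace (top_of_set realised)" and e: "0 < e"
  then have x: "x \<in> realised" by simp
  have "realisation y \<in> PC.mball (realisation x) e" if "y \<in> realised \<inter> ball x e" for y
    using polygon_dist_realisation[OF x, of y] realisation(1)[OF x] realisation(1)[of y] that \<O>(1)
    by (auto simp: dist_norm)
  then show "\<exists>U. openin (top_of_set realised) U \<and> x \<in> U \<and> (\<forall>y\<in>U. realisation y \<in> PC.mball (realisation x) e)"
    using x e by (intro exI[of _ "realised \<inter> ball x e"]) (auto simp: openin_open)
qed

text \<open>
  The compact curve \<open>h\<close> has a neighbourhood of radius \<open>r\<close> in the open set of realised vectors. A point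
  of that neighbourhood has the same first \<open>N\<close> coordinates as a point of the sum of the curve and an
  \<open>N\<close>-dimensional cube of half-width \<open>r\<close>; the sum is compact, and \<open>K\<close> consists of the polygons with these heights.
\<close>

lemma polygonal_motion_tube:
  fixes T :: real and \<Gamma> :: "real \<Rightarrow> complex list"
  assumes \<Gamma>: "\<And>t. t \<in> {0..T} \<Longrightarrow> \<Gamma> t \<in> \<O>"
    and cont: "\<And>j. j < length \<nu> \<Longrightarrow> continuous_on {0..T} (\<lambda>t. height \<nu> (\<Gamma> t) j)"
  defines "h \<equiv> \<lambda>t. coord_vec (length \<nu>) (height \<nu> (\<Gamma> t))"
  obtains r K where "0 < r" "compactin (polygon_topology \<nu>) K" "K \<subseteq> \<O>"
    "\<And>x. x \<in> {x. \<exists>t\<in>{0..T}. dist (h t) x \<le> r} \<Longrightarrow> x \<in> realised \<and> realisation x \<in> K"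
proof -
  let ?N = "length \<nu>"
  have "continuous_on {0..T} h" unfolding h_def using cont by (intro continuous_on_coord_vec)
  then have comp: "compact (h ` {0..T})" by (intro compact_continuous_image) auto
  have "h ` {0..T} \<subseteq> realised" using realisation_vec(1)[OF \<Gamma>] by (auto simp: h_def)
  then obtain r where r: "0 < r" "(\<Union>x\<in>h ` {0..T}. cball x r) \<subseteq> realised"
    using compact_subset_open_imp_cball_epsilon_subset[OF comp open_realised] by blast
  define C where "C = {x + y | x y. x \<in> h ` {0..T} \<and> y \<in> {coord_vec ?N b | b. \<forall>j<?N. \<bar>b j\<bar> \<le> r}}"
  have tube: "x \<in> realised" if "t \<in> {0..T}" "dist (h t) x \<le> r" for x t
  proof -
    have "x \<in> cball (h t) r" using that by simp
    then show ?thesis using r(2) that(1) by blast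
  qed
  have "C \<subseteq> realised"
  proof
    fix z assume "z \<in> C"
    then obtain t b where z: "t \<in> {0..T}" "z = h t + coord_vec ?N b" "\<forall>j<?N. \<bar>b j\<bar> \<le> r"
      by (auto simp: C_def)
    then have "dist (h t) z \<le> r" using norm_coord_vec_le[of ?N b r] r(1) by (simp add: dist_norm)
    then show "z \<in> realised" using tube z(1) by blast
  qed
  moreover have "compact C" unfolding C_def by (intro compact_sums comp compact_coord_box less_imp_le r(1))
  ultimately have K: "compactin (polygon_topology \<nu>) (realisation ` C)"
    by (intro image_compactin[OF _ continuous_map_realisation]) (simp add: compactin_subtopology)
  show thesis
  proof (rule that[OF r(1) K])
    show "realisation ` C \<subseteq> \<O>" using \<open>C \<subseteq> realised\<close> realisation(1) by blast
    fix x assume "x \<in> {x. \<exists>t\<in>{0..T}. dist (h t) x \<le> r}"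
    then obtain t where t: "t \<in> {0..T}" "dist (h t) x \<le> r" by blast
    have x: "x \<in> realised" using tube t by blast
    have "\<bar>apply_bcontfun x j - apply_bcontfun (h t) j\<bar> \<le> r" for j
      using norm_bounded[of "x - h t" j] t(2) by (simp add: dist_norm norm_minus_commute)
    then have mem: "h t + coord_vec ?N (\<lambda>j. apply_bcontfun x j - apply_bcontfun (h t) j) \<in> C"
      unfolding C_def using t(1) by blast
    have "realisation (h t + coord_vec ?N (\<lambda>j. apply_bcontfun x j - apply_bcontfun (h t) j)) = realisation x"
      by (intro realisation_eqI) (simp_all add: realisation[OF x] coord_vec_apply)
    with imageI[OF mem, of realisation] x show "x \<in> realised \<and> realisation x \<in> realisation ` C" by simp
  qed
qed

end

section \<open>Convergence of the scheme for polygonal motions\<close>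

theorem theorem4p5:
  fixes \<nu> :: "complex list"
    and \<O> :: "complex list set"
    and Tstar :: ereal
    and F :: "complex list \<Rightarrow> real \<Rightarrow> nat \<Rightarrow> real"
    and T :: real
    and k :: nat
    and \<Gamma> :: "real \<Rightarrow> complex list"
    and \<Gamma>star :: "complex list"
  assumes "\<O> \<subseteq> polygon_class \<nu>" and "openin (polygon_topology \<nu>) \<O>"
    and "0 < Tstar"
    and "\<And>j. j < length \<nu> \<Longrightarrow>
          continuous_map
            (prod_topology (subtopology (polygon_topology \<nu>) \<O>)
                           (top_of_set {t. 0 \<le> t \<and> ereal t < Tstar}))
            euclideanreal (\<lambda>(\<Sigma>, t). F \<Sigma> t j)"
    and "\<And>K S. \<lbrakk>compactin (polygon_topology \<nu>) K; K \<subseteq> \<O>; 0 < S; ereal S < Tstar\<rbrakk> \<Longrightarrow>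
          \<exists>L>0. \<forall>\<Sigma>\<in>K. \<forall>\<Sigma>'\<in>K. \<forall>t\<in>{0..S}.
            max_norm (length \<nu>) (\<lambda>j. F \<Sigma> t j - F \<Sigma>' t j) \<le> L * polygon_dist \<nu> \<Sigma> \<Sigma>'"
    and "0 < T" and "ereal T < Tstar"
    and "k \<in> {0, 1, 2}"
    and "\<Gamma>star \<in> \<O>"
    and "\<And>t. t \<in> {0..T} \<Longrightarrow> \<Gamma> t \<in> \<O>"
    and "\<And>j. j < length \<nu> \<Longrightarrow> C_class_on (k + 1) (\<lambda>t. height \<nu> (\<Gamma> t) j) {0..T}"
    and "\<And>j t. \<lbrakk>j < length \<nu>; t \<in> {0..T}\<rbrakk> \<Longrightarrow>
          ((\<lambda>s. height \<nu> (\<Gamma> s) j) has_real_derivative F (\<Gamma> t) t j) (at t within {0..T})"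
    and "\<Gamma> 0 = \<Gamma>star"
  shows "\<exists>\<delta>star>0. \<exists>\<tau>star>0. \<exists>C>0. \<exists>\<rho>>0. \<exists>\<omega> :: real \<Rightarrow> real.
     mono_on {0<..} \<omega> \<and> (\<forall>a>0. 0 < \<omega> a) \<and>
     (k \<in> {0, 1} \<longrightarrow> \<omega> \<in> o[at_right 0](\<lambda>a. a ^ k)) \<and>
     (k = 2 \<longrightarrow> \<omega> \<in> O[at_right 0](\<lambda>a. a ^ 2)) \<and>
     (\<forall>(M :: nat) (t :: nat \<Rightarrow> real) \<tau> \<Gamma>0.
        1 \<le> M \<and> t 0 = 0 \<and> (\<forall>m<M. t m < t (m + 1)) \<and> t M \<le> T \<and>
        \<tau> = (MAX m\<in>{..<M}. t (m + 1) - t m) \<and> \<tau> \<le> \<tau>star \<and>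
        \<Gamma>0 \<in> \<O> \<and> polygon_dist \<nu> \<Gamma>star \<Gamma>0 \<le> \<delta>star \<longrightarrow>
        (\<exists>G :: nat \<Rightarrow> complex list.
           G 0 = \<Gamma>0 \<and>
           (\<forall>m\<le>M. G m \<in> \<O>) \<and>
           (\<forall>m<M. scheme_step \<nu> \<O> F (t m) (t (m + 1)) (G m) (G (m + 1)) \<and>
                  polygon_dist \<nu> (G m) (G (m + 1)) \<le> \<rho> \<and>
                  (\<forall>\<Sigma>\<in>\<O>. scheme_step \<nu> \<O> F (t m) (t (m + 1)) (G m) \<Sigma> \<and>
                          polygon_dist \<nu> (G m) \<Sigma> \<le> \<rho> \<longrightarrow> \<Sigma> = G (m + 1))) \<and>
           (MAX m\<in>{..M}. polygon_dist \<nu> (\<Gamma> (t m)) (G m))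
             \<le> \<omega> \<tau> + C * polygon_dist \<nu> (\<Gamma> 0) \<Gamma>0))"
proof -
  let ?N = "length \<nu>"
  have star: "\<Gamma>star \<in> polygon_class \<nu>" using assms(1,9) by blast
  then have \<nu>: "\<nu> \<noteq> []" and N: "0 < ?N"
    using polygon_length(2)[of \<Gamma>star] by (auto simp: polygon_class_def)
  note \<O> = assms(1,2)
  note T = \<open>0 < T\<close> and k = \<open>k \<in> {0, 1, 2}\<close>
  define h where "h t = coord_vec ?N (height \<nu> (\<Gamma> t))" for t
  have cont: "continuous_on {0..T} (\<lambda>t. height \<nu> (\<Gamma> t) j)" if "j < ?N" for j
    using assms(12)[OF that] by (rule DERIV_continuous_on)
  obtain r K where r: "0 < r" and K: "compactin (polygon_topology \<nu>) K" "K \<subseteq> \<O>"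
    and tube: "\<And>x. x \<in> {x. \<exists>t\<in>{0..T}. dist (h t) x \<le> r} \<Longrightarrow> x \<in> realised \<nu> \<O> \<and> realisation \<nu> \<O> x \<in> K"
    using polygonal_motion_tube[OF \<nu> \<O> assms(10) cont] unfolding h_def by blast
  define U where "U = {x. \<exists>t\<in>{0..T}. dist (h t) x \<le> r}"
  define Q where "Q = realisation \<nu> \<O>"
  have UQ: "x \<in> realised \<nu> \<O>" "Q x \<in> K" "Q x \<in> \<O>" if "x \<in> U" for x
    using tube[of x] that K(2) by (auto simp: U_def Q_def)
  have Qh: "height \<nu> (Q x) j = apply_bcontfun x j" if "x \<in> U" "j < ?N" for x j
    unfolding Q_def using realisation(2)[OF \<nu> \<O> UQ(1)[OF that(1)] that(2)] .
  have Q_eq: "Q x = v" if "v \<in> \<O>" "\<And>j. j < ?N \<Longrightarrow> height \<nu> v j = apply_bcontfun x j" for x v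
    unfolding Q_def using realisation_eqI(2)[OF \<nu> \<O> that] .
  have Q_dist: "polygon_dist \<nu> (Q x) (Q y) \<le> norm (x - y)" if "x \<in> U" "y \<in> U" for x y
    unfolding Q_def using polygon_dist_realisation[OF \<nu> \<O>] UQ(1) that by blast
  have hU: "h t \<in> U" and Qh_eq: "Q (h t) = \<Gamma> t" if "t \<in> {0..T}" for t
    using that r realisation_vec(2)[OF \<nu> \<O> assms(10)[OF that]]
    by (auto simp: U_def Q_def h_def intro!: bexI[of _ t])
  define f where "f x s = coord_vec ?N (F (Q x) s)" for x s
  obtain L where L: "0 < L" "\<And>v w s. v \<in> K \<Longrightarrow> w \<in> K \<Longrightarrow> s \<in> {0..T} \<Longrightarrow>
      max_norm ?N (\<lambda>j. F v s j - F w s j) \<le> L * polygon_dist \<nu> v w"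
    using assms(5)[OF K T assms(7)] by blast
  have lip: "norm (f x s - f y s) \<le> L * norm (x - y)" if "x \<in> U" "y \<in> U" "s \<in> {0..T}" for x y s
  proof -
    have "norm (f x s - f y s) \<le> L * polygon_dist \<nu> (Q x) (Q y)"
      using L(2)[OF UQ(2)[OF that(1)] UQ(2)[OF that(2)] that(3)] N
      by (simp add: f_def coord_vec_diff norm_coord_vec)
    also have "\<dots> \<le> L * norm (x - y)" using Q_dist[OF that(1,2)] L(1) by (intro mult_left_mono) auto
    finally show ?thesis .
  qed
  have "\<exists>B. \<forall>v\<in>K. \<forall>s\<in>{0..T}. \<bar>F v s j\<bar> \<le> B" if j: "j < ?N" for j
  proof -
    \<comment> \<open>\<open>F\<close> is continuous on the compact set \<open>K \<times> {0..T}\<close>.\<close>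
    have "compactin (subtopology (polygon_topology \<nu>) \<O>) K"
      using K by (simp add: compactin_subtopology)
    moreover have "{0..T} \<subseteq> {t. 0 \<le> t \<and> ereal t < Tstar}"
      using assms(7) by (auto intro: le_less_trans[of _ "ereal T"])
    then have "compactin (top_of_set {t. 0 \<le> t \<and> ereal t < Tstar}) {0..T}"
      by (simp add: compactin_subtopology)
    ultimately have "compactin (prod_topology (subtopology (polygon_topology \<nu>) \<O>)
        (top_of_set {t. 0 \<le> t \<and> ereal t < Tstar})) (K \<times> {0..T})"
      by (simp add: compactin_Times)
    from image_compactin[OF this assms(4)[OF j]]
    have "bounded ((\<lambda>(v, s). F v s j) ` (K \<times> {0..T}))" by (simp add: compact_imp_bounded)
    then show ?thesis by (auto simp: bounded_iff)
  qed
  then obtain b where b: "\<And>j v s. j < ?N \<Longrightarrow> v \<in> K \<Longrightarrow> s \<in> {0..T} \<Longrightarrow> \<bar>F v s j\<bar> \<le> b j" by metis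
  define B where "B = (\<Sum>j<?N. \<bar>b j\<bar>)"
  have B: "0 \<le> B" unfolding B_def by (intro sum_nonneg) auto
  have bound: "norm (f x s) \<le> B" if "x \<in> U" "s \<in> {0..T}" for x s
    unfolding f_def norm_coord_vec_le
  proof (intro conjI allI impI B)
    fix j assume j: "j < ?N"
    have "\<bar>F (Q x) s j\<bar> \<le> \<bar>b j\<bar>" using b[OF j UQ(2)[OF that(1)] that(2)] by simp
    also have "\<dots> \<le> B" unfolding B_def using j by (intro member_le_sum) auto
    finally show "\<bar>F (Q x) s j\<bar> \<le> B" .
  qed
  have "\<exists>\<omega>. convergence_rate k \<omega> \<and> (\<forall>t t'. 0 \<le> t \<longrightarrow> t < t' \<longrightarrow> t' \<le> T \<longrightarrow>
      \<bar>height \<nu> (\<Gamma> t') j - height \<nu> (\<Gamma> t) j - (t' - t) * F (\<Gamma> ((t + t') / 2)) ((t + t') / 2) j\<bar>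
        \<le> (t' - t) * \<omega> (t' - t) \<and>
      \<bar>height \<nu> (\<Gamma> ((t + t') / 2)) j - (height \<nu> (\<Gamma> t) j + height \<nu> (\<Gamma> t') j) / 2\<bar> \<le> \<omega> (t' - t))"
    if j: "j < ?N" for j
  proof -
    obtain \<omega> where \<omega>: "convergence_rate k \<omega>"
      "\<And>t t' g'. \<lbrakk>0 \<le> t; t < t'; t' \<le> T;
        ((\<lambda>t. height \<nu> (\<Gamma> t) j) has_real_derivative g') (at ((t + t') / 2) within {0..T})\<rbrakk> \<Longrightarrow>
      \<bar>height \<nu> (\<Gamma> t') j - height \<nu> (\<Gamma> t) j - (t' - t) * g'\<bar> \<le> (t' - t) * \<omega> (t' - t) \<and>
      \<bar>height \<nu> (\<Gamma> ((t + t') / 2)) j - (height \<nu> (\<Gamma> t) j + height \<nu> (\<Gamma> t') j) / 2\<bar> \<le> \<omega> (t' - t)"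
      using midpoint_consistency[OF T k assms(11)[OF j]] by blast
    have "(t + t') / 2 \<in> {0..T}" if "0 \<le> t" "t < t'" "t' \<le> T" for t t'
      using that by auto
    then show ?thesis using \<omega> assms(12)[OF j] by blast
  qed
  then obtain \<omega>c where \<omega>c: "\<And>j. j < ?N \<Longrightarrow> convergence_rate k (\<omega>c j)"
    "\<And>j t t'. \<lbrakk>j < ?N; 0 \<le> t; t < t'; t' \<le> T\<rbrakk> \<Longrightarrow>
      \<bar>height \<nu> (\<Gamma> t') j - height \<nu> (\<Gamma> t) j - (t' - t) * F (\<Gamma> ((t + t') / 2)) ((t + t') / 2) j\<bar>
        \<le> (t' - t) * \<omega>c j (t' - t) \<and>
      \<bar>height \<nu> (\<Gamma> ((t + t') / 2)) j - (height \<nu> (\<Gamma> t) j + height \<nu> (\<Gamma> t') j) / 2\<bar> \<le> \<omega>c j (t' - t)"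
    by metis
  \<comment> \<open>The sum over the edges bounds all components at once and is again a rate.\<close>
  define \<theta> where "\<theta> a = (\<Sum>j<?N. \<omega>c j a)" for a
  have \<theta>: "convergence_rate k \<theta>"
    unfolding \<theta>_def using N \<omega>c(1) by (intro convergence_rate_sum) (auto simp: lessThan_empty_iff)
  then have \<theta>_mono: "\<theta> a \<le> \<theta> a'" if "0 < a" "a \<le> a'" for a a'
    using that by (auto simp: convergence_rate_def monotone_on_def)
  have \<theta>_pos: "0 < \<theta> a" if "0 < a" for a using \<theta> that by (simp add: convergence_rate_def)
  have \<omega>c_le: "\<omega>c j a \<le> \<theta> a" if "j < ?N" "0 < a" for j a
    unfolding \<theta>_def using that \<omega>c(1)
    by (intro member_le_sum) (auto simp: convergence_rate_def intro: less_imp_le)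
  have cons: "midpoint (h t) (h t') \<in> U \<and>
      norm (h t' - h t - (t' - t) *\<^sub>R f (midpoint (h t) (h t')) ((t + t') / 2))
        \<le> (t' - t) * ((1 + L) * \<theta> a)"
    if t: "0 \<le> t" "t < t'" "t' \<le> T" "t' - t \<le> a" and a: "\<theta> a \<le> r" for t t' a
  proof -
    \<comment> \<open>The state at the midpoint in time and the mean of the two states differ by at most \<open>\<theta> a\<close>. Hence the
      latter lies in the tube, and exchanging them in \<open>f\<close> costs at most \<open>L \<theta> a\<close>.\<close>
    define s p where "s = (t + t') / 2" and "p = midpoint (h t) (h t')"
    have s: "s \<in> {0..T}" using t by (auto simp: s_def)
    have \<theta>a: "\<theta> (t' - t) \<le> \<theta> a" using t by (intro \<theta>_mono) auto
    have pos: "0 < \<theta> (t' - t)" using t by (intro \<theta>_pos) auto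
    have "p = coord_vec ?N (\<lambda>j. (height \<nu> (\<Gamma> t) j + height \<nu> (\<Gamma> t') j) / 2)"
      by (rule bcontfun_eqI) (simp add: p_def midpoint_def h_def coord_vec_apply)
    then have "norm (h s - p) \<le> \<theta> (t' - t)"
      using pos \<omega>c(2)[OF _ t(1-3)] \<omega>c_le[of _ "t' - t"] t
      unfolding h_def s_def by (simp add: coord_vec_diff norm_coord_vec_le) (meson order_trans)
    then have hp: "norm (h s - p) \<le> \<theta> a" using \<theta>a by simp
    then have p: "p \<in> U" unfolding U_def using s a by (auto simp: dist_norm intro!: bexI[of _ s])
    have "norm (h t' - h t - (t' - t) *\<^sub>R f (h s) s) \<le> (t' - t) * \<theta> (t' - t)"
      unfolding h_def[of t] h_def[of t'] f_def Qh_eq[OF s] coord_vec_diff coord_vec_scaleR norm_coord_vec_le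
    proof (intro conjI allI impI)
      fix j assume j: "j < ?N"
      have "\<bar>height \<nu> (\<Gamma> t') j - height \<nu> (\<Gamma> t) j - (t' - t) * F (\<Gamma> s) s j\<bar> \<le> (t' - t) * \<omega>c j (t' - t)"
        using \<omega>c(2)[OF j t(1-3)] by (simp add: s_def)
      also have "\<dots> \<le> (t' - t) * \<theta> (t' - t)" using \<omega>c_le[OF j] t by (intro mult_left_mono) auto
      finally show "\<bar>height \<nu> (\<Gamma> t') j - height \<nu> (\<Gamma> t) j - (t' - t) * F (\<Gamma> s) s j\<bar> \<le> (t' - t) * \<theta> (t' - t)" .
    qed (use t pos in auto)
    also have "\<dots> \<le> (t' - t) * \<theta> a" using \<theta>a t by (intro mult_left_mono) auto
    finally have 1: "norm (h t' - h t - (t' - t) *\<^sub>R f (h s) s) \<le> (t' - t) * \<theta> a" .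
    have "norm (f (h s) s - f p s) \<le> L * \<theta> a"
      using lip[OF hU[OF s] p s] mult_left_mono[OF hp less_imp_le[OF L(1)]] by (rule order_trans)
    then have 2: "norm ((t' - t) *\<^sub>R (f (h s) s - f p s)) \<le> (t' - t) * (L * \<theta> a)"
      using t by (simp add: mult_left_mono)
    have eq: "h t' - h t - (t' - t) *\<^sub>R f p s =
        (h t' - h t - (t' - t) *\<^sub>R f (h s) s) + (t' - t) *\<^sub>R (f (h s) s - f p s)"
      by (simp add: algebra_simps)
    have "norm (h t' - h t - (t' - t) *\<^sub>R f p s) \<le> (t' - t) * \<theta> a + (t' - t) * (L * \<theta> a)"
      unfolding eq by (rule norm_triangle_mono[OF 1 2])
    then show ?thesis using p by (simp add: p_def s_def algebra_simps)
  qed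
  define C where "C = exp (2 * L * T)"
  define c where "c = C * (2 * T * (1 + L))"
  define \<omega> where "\<omega> a = c * \<theta> a" for a
  have C: "0 < C" and c: "0 < c" using T L(1) by (auto simp: C_def c_def)
  have rate: "convergence_rate k \<omega>" unfolding \<omega>_def using c \<theta> by (rule convergence_rate_cmult)
  obtain a where a: "0 < a" "\<theta> a \<le> min r (r / (4 * c))"
    using convergence_rate_small[OF \<theta> k, of "min r (r / (4 * c))"] r c by auto
  \<comment> \<open>Both contributions to the final error, \<open>\<omega> \<tau>\<close> and \<open>C\<close> times the initial error, are kept below \<open>r / 4\<close>. The
    bounds \<open>r / (B + 1)\<close> and \<open>1 / L\<close> are those of the contraction argument; \<open>B + 1\<close> replaces \<open>B\<close>, which may
    be \<open>0\<close>.\<close>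
  define \<tau>star where "\<tau>star = min a (min (r / (B + 1)) (1 / L))"
  define \<delta>star where "\<delta>star = r / (4 * C)"
  have pos: "0 < \<tau>star" "0 < \<delta>star" using a r B L C by (auto simp: \<tau>star_def \<delta>star_def)
  have scheme: "\<exists>G. G 0 = \<Gamma>0 \<and> (\<forall>m\<le>M. G m \<in> \<O>) \<and>
      (\<forall>m<M. scheme_step \<nu> \<O> F (t m) (t (m + 1)) (G m) (G (m + 1)) \<and>
        polygon_dist \<nu> (G m) (G (m + 1)) \<le> r \<and>
        (\<forall>\<Sigma>\<in>\<O>. scheme_step \<nu> \<O> F (t m) (t (m + 1)) (G m) \<Sigma> \<and> polygon_dist \<nu> (G m) \<Sigma> \<le> r \<longrightarrow>
          \<Sigma> = G (m + 1))) \<and>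
      (MAX m\<in>{..M}. polygon_dist \<nu> (\<Gamma> (t m)) (G m)) \<le> \<omega> \<tau> + C * polygon_dist \<nu> (\<Gamma> 0) \<Gamma>0"
    if M: "1 \<le> M" and t: "t 0 = 0" "\<forall>m<M. t m < t (m + 1)" "t M \<le> T"
      and \<tau>: "\<tau> = (MAX m\<in>{..<M}. t (m + 1) - t m)" "\<tau> \<le> \<tau>star"
      and \<Gamma>0: "\<Gamma>0 \<in> \<O>" "polygon_dist \<nu> \<Gamma>star \<Gamma>0 \<le> \<delta>star"
    for M :: nat and t :: "nat \<Rightarrow> real" and \<tau> \<Gamma>0
  proof -
    have step_le: "t (Suc m) - t m \<le> \<tau>" if "m < M" for m
      unfolding \<tau>(1) using that by (intro Max_ge) auto
    have "0 < \<tau>" using step_le[of 0] t(2) M by force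
    define x0 where "x0 = coord_vec ?N (height \<nu> \<Gamma>0)"
    have e0: "norm (h 0 - x0) = polygon_dist \<nu> (\<Gamma> 0) \<Gamma>0"
      unfolding h_def x0_def by (rule polygon_dist_vec[OF \<nu> \<O>, symmetric])
    have \<theta>\<tau>: "\<theta> \<tau> \<le> r" "c * \<theta> \<tau> \<le> r / 4"
    proof -
      have "\<theta> \<tau> \<le> min r (r / (4 * c))"
        using \<theta>_mono[of \<tau> a] \<open>0 < \<tau>\<close> \<tau>(2) a(2) by (simp add: \<tau>star_def)
      then show "\<theta> \<tau> \<le> r" "c * \<theta> \<tau> \<le> r / 4" using c by (auto simp: field_simps)
    qed
    have total: "C * (norm (h 0 - x0) + 2 * T * ((1 + L) * \<theta> \<tau>)) = \<omega> \<tau> + C * polygon_dist \<nu> (\<Gamma> 0) \<Gamma>0"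
      by (simp add: e0 \<omega>_def c_def algebra_simps)
    have small: "\<omega> \<tau> + C * polygon_dist \<nu> (\<Gamma> 0) \<Gamma>0 \<le> r / 2"
    proof -
      have "C * polygon_dist \<nu> (\<Gamma> 0) \<Gamma>0 \<le> C * \<delta>star"
        using \<Gamma>0(2) assms(13) C by (intro mult_left_mono) auto
      also have "\<dots> = r / 4" using C by (simp add: \<delta>star_def)
      finally show ?thesis using \<theta>\<tau>(2) by (simp add: \<omega>_def)
    qed
    have "\<exists>x. x 0 = x0 \<and>
      (\<forall>m\<le>M. norm (h (t m) - x m) \<le> exp (2 * L * T) * (norm (h 0 - x0) + 2 * T * ((1 + L) * \<theta> \<tau>))) \<and>
      (\<forall>m<M. \<forall>y. (y = x m + (t (Suc m) - t m) *\<^sub>R f (midpoint (x m) y) ((t m + t (Suc m)) / 2) \<and>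
        norm (y - x m) \<le> r) \<longleftrightarrow> y = x (Suc m))"
    proof (rule implicit_midpoint_convergence[where B = B and a = \<tau> and f = f and h = h and t = t])
      show "norm (f x s) \<le> B" if "x \<in> {x. \<exists>t\<in>{0..T}. dist (h t) x \<le> r}" "s \<in> {0..T}" for x s
        using bound that by (simp add: U_def)
      show "norm (f x s - f y s) \<le> L * norm (x - y)"
        if "x \<in> {x. \<exists>t\<in>{0..T}. dist (h t) x \<le> r}" "y \<in> {x. \<exists>t\<in>{0..T}. dist (h t) x \<le> r}" "s \<in> {0..T}"
        for x y s using lip that by (simp add: U_def)
      show "midpoint (h t) (h t') \<in> {x. \<exists>t\<in>{0..T}. dist (h t) x \<le> r} \<and>
          norm (h t' - h t - (t' - t) *\<^sub>R f (midpoint (h t) (h t')) ((t + t') / 2))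
            \<le> (t' - t) * ((1 + L) * \<theta> \<tau>)"
        if "0 \<le> t" "t < t'" "t' \<le> T" "t' - t \<le> \<tau>" for t t'
        using cons[OF that \<theta>\<tau>(1)] by (simp add: U_def)
      have "\<tau> \<le> r / (B + 1)" "\<tau> \<le> 1 / L" using \<tau>(2) by (auto simp: \<tau>star_def)
      then have "\<tau> * (B + 1) \<le> r" "\<tau> * L \<le> 1" using B L(1) by (auto simp: field_simps)
      then show "\<tau> * B \<le> r" "\<tau> * L \<le> 1" using \<open>0 < \<tau>\<close> by (auto simp: algebra_simps)
      show "exp (2 * L * T) * (norm (h 0 - x0) + 2 * T * ((1 + L) * \<theta> \<tau>)) \<le> r / 2"
        unfolding C_def[symmetric] total using small .
    qed (use r L(1) B t step_le \<theta>_pos[OF \<open>0 < \<tau>\<close>] in auto)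
    then obtain x where x0: "x 0 = x0"
      and err: "\<And>m. m \<le> M \<Longrightarrow> norm (h (t m) - x m) \<le> \<omega> \<tau> + C * polygon_dist \<nu> (\<Gamma> 0) \<Gamma>0"
      and step_iff: "\<And>m y. m < M \<Longrightarrow>
        y = x m + (t (Suc m) - t m) *\<^sub>R f (midpoint (x m) y) ((t m + t (Suc m)) / 2) \<and> norm (y - x m) \<le> r
          \<longleftrightarrow> y = x (Suc m)"
      unfolding C_def[symmetric] total by blast
    have grid: "t m \<in> {0..T}" if "m \<le> M" for m
    proof -
      have "t i \<le> t j" if "i \<le> j" "j \<le> M" for i j
        using that
      proof (induction j rule: dec_induct)
        case (step n) then show ?case using t(2)[rule_format, of n] by simp
      qed simp
      from this[of 0 m] this[of m M] show ?thesis using t that by simp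
    qed
    have near_U: "y \<in> U" if "m \<le> M" "norm (y - x m) \<le> r / 2" for m y
    proof -
      have "norm (h (t m) - y) \<le> norm (h (t m) - x m) + norm (y - x m)"
        using norm_triangle_ineq4[of "h (t m) - x m" "y - x m"] by simp
      then have "dist (h (t m)) y \<le> r" using err[OF that(1)] small that(2) by (simp add: dist_norm)
      then show ?thesis unfolding U_def using grid[OF that(1)] by blast
    qed
    have xU: "x m \<in> U" if "m \<le> M" for m using near_U[OF that, of "x m"] r by simp
    have mid_U: "midpoint (x m) y \<in> U" if "m < M" "norm (y - x m) \<le> r" for m y
      using near_U[of m "midpoint (x m) y"] that by (simp add: midpoint_eq_add)
    define G where "G m = Q (x m)" for m
    have GO: "G m \<in> \<O>" if "m \<le> M" for m using UQ(3)[OF xU[OF that]] by (simp add: G_def)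
    have Gh: "height \<nu> (G m) j = apply_bcontfun (x m) j" if "m \<le> M" "j < ?N" for m j
      using Qh[OF xU[OF that(1)] that(2)] by (simp add: G_def)
    have mid_apply: "apply_bcontfun (midpoint y z) j = (apply_bcontfun y j + apply_bcontfun z j) / 2"
      for y z :: "nat \<Rightarrow>\<^sub>C real" and j
      by (simp add: midpoint_def)
    have "G 0 = \<Gamma>0"
      unfolding G_def x0 x0_def using \<Gamma>0(1) by (intro Q_eq) (auto simp: coord_vec_apply)
    moreover have "scheme_step \<nu> \<O> F (t m) (t (m + 1)) (G m) (G (m + 1)) \<and>
        polygon_dist \<nu> (G m) (G (m + 1)) \<le> r" if m: "m < M" for m
    proof
      let ?s = "(t m + t (Suc m)) / 2" and ?p = "midpoint (x m) (x (Suc m))"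
      have \<tau>m: "0 < t (Suc m) - t m" using t(2) m by simp
      have st: "x (Suc m) = x m + (t (Suc m) - t m) *\<^sub>R f ?p ?s" and near: "norm (x (Suc m) - x m) \<le> r"
        using step_iff[OF m, of "x (Suc m)"] by blast+
      have p: "?p \<in> U" using mid_U[OF m near] .
      have "apply_bcontfun (x (Suc m)) j = apply_bcontfun (x m) j + (t (Suc m) - t m) * F (Q ?p) ?s j"
        if "j < ?N" for j
        using arg_cong[OF st, of "\<lambda>y. apply_bcontfun y j"] that by (simp add: f_def coord_vec_apply)
      then have "(height \<nu> (G (Suc m)) j - height \<nu> (G m) j) / (t (Suc m) - t m) = F (Q ?p) ?s j"
        if "j < ?N" for j
        using that Gh[of m j] Gh[of "Suc m" j] m \<tau>m by simp
      moreover have "is_interpolation \<nu> (G m) (G (Suc m)) (Q ?p)"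
        unfolding is_interpolation_def
        using Qh[OF p] UQ(3)[OF p] \<O>(1) Gh[of m] Gh[of "Suc m"] m by (auto simp: mid_apply)
      ultimately show "scheme_step \<nu> \<O> F (t m) (t (m + 1)) (G m) (G (m + 1))"
        unfolding scheme_step_def using UQ(3)[OF p] by auto
      show "polygon_dist \<nu> (G m) (G (m + 1)) \<le> r"
        using Q_dist[OF xU[of m] xU[of "Suc m"]] near m by (simp add: G_def norm_minus_commute)
    qed
    moreover have "\<Sigma> = G (m + 1)"
      if m: "m < M" and \<Sigma>: "\<Sigma> \<in> \<O>"
        "scheme_step \<nu> \<O> F (t m) (t (m + 1)) (G m) \<Sigma> \<and> polygon_dist \<nu> (G m) \<Sigma> \<le> r" for m \<Sigma>
    proof -
      let ?s = "(t m + t (Suc m)) / 2"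
      \<comment> \<open>The heights of \<open>\<Sigma>\<close> are completed by the remaining coordinates of \<open>x m\<close>, so that \<open>y\<close> solves the
        equation of the step in the whole space.\<close>
      define y where "y = x m + coord_vec ?N (\<lambda>j. height \<nu> \<Sigma> j - height \<nu> (G m) j)"
      have y: "apply_bcontfun y j = height \<nu> \<Sigma> j" if "j < ?N" for j
        using that Gh[of m j] m by (simp add: y_def coord_vec_apply)
      obtain u where u: "u \<in> \<O>" "is_interpolation \<nu> (G m) \<Sigma> u"
        "\<And>j. j < ?N \<Longrightarrow> (height \<nu> \<Sigma> j - height \<nu> (G m) j) / (t (Suc m) - t m) = F u ?s j"
        using \<Sigma>(2) by (auto simp: scheme_step_def)
      have Qu: "Q (midpoint (x m) y) = u"
        using u(1,2) y Gh[of m] m by (intro Q_eq) (auto simp: is_interpolation_def mid_apply)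
      have "0 < t (Suc m) - t m" using t(2) m by simp
      then have "height \<nu> \<Sigma> j - height \<nu> (G m) j = (t (Suc m) - t m) * F u ?s j" if "j < ?N" for j
        using u(3)[OF that, symmetric] by simp
      then have "y = x m + (t (Suc m) - t m) *\<^sub>R f (midpoint (x m) y) ?s"
        unfolding f_def Qu by (simp add: y_def coord_vec_scaleR cong: coord_vec_cong)
      moreover have "norm (y - x m) \<le> r"
        using \<Sigma>(2) polygon_dist_vec[OF \<nu> \<O>, of "G m" \<Sigma>]
        by (simp add: y_def coord_vec_diff[symmetric] norm_minus_commute)
      ultimately have "y = x (Suc m)" using step_iff[OF m] by blast
      then show "\<Sigma> = G (m + 1)" using Q_eq[OF \<Sigma>(1), of y] y by (simp add: G_def)
    qed
    moreover have "(MAX m\<in>{..M}. polygon_dist \<nu> (\<Gamma> (t m)) (G m)) \<le> \<omega> \<tau> + C * polygon_dist \<nu> (\<Gamma> 0) \<Gamma>0"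
    proof -
      have "polygon_dist \<nu> (\<Gamma> (t m)) (G m) \<le> \<omega> \<tau> + C * polygon_dist \<nu> (\<Gamma> 0) \<Gamma>0" if "m \<le> M" for m
        using Q_dist[OF hU[OF grid[OF that]] xU[OF that]] err[OF that] Qh_eq[OF grid[OF that]]
        by (simp add: G_def)
      then show ?thesis by (subst Max_le_iff) auto
    qed
    ultimately show ?thesis using GO by (intro exI[of _ G]) blast
  qed
  show ?thesis
  proof (rule exI[of _ \<delta>star], rule conjI[OF pos(2)], rule exI[of _ \<tau>star], rule conjI[OF pos(1)],
      rule exI[of _ C], rule conjI[OF C], rule exI[of _ r], rule conjI[OF r], rule exI[of _ \<omega>], intro conjI)
    show "\<forall>(M :: nat) (t :: nat \<Rightarrow> real) \<tau> \<Gamma>0.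
        1 \<le> M \<and> t 0 = 0 \<and> (\<forall>m<M. t m < t (m + 1)) \<and> t M \<le> T \<and>
        \<tau> = (MAX m\<in>{..<M}. t (m + 1) - t m) \<and> \<tau> \<le> \<tau>star \<and>
        \<Gamma>0 \<in> \<O> \<and> polygon_dist \<nu> \<Gamma>star \<Gamma>0 \<le> \<delta>star \<longrightarrow>
        (\<exists>G :: nat \<Rightarrow> complex list.
           G 0 = \<Gamma>0 \<and>
           (\<forall>m\<le>M. G m \<in> \<O>) \<and>
           (\<forall>m<M. scheme_step \<nu> \<O> F (t m) (t (m + 1)) (G m) (G (m + 1)) \<and>
                  polygon_dist \<nu> (G m) (G (m + 1)) \<le> r \<and>
                  (\<forall>\<Sigma>\<in>\<O>. scheme_step \<nu> \<O> F (t m) (t (m + 1)) (G m) \<Sigma> \<and>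
                          polygon_dist \<nu> (G m) \<Sigma> \<le> r \<longrightarrow> \<Sigma> = G (m + 1))) \<and>
           (MAX m\<in>{..M}. polygon_dist \<nu> (\<Gamma> (t m)) (G m))
             \<le> \<omega> \<tau> + C * polygon_dist \<nu> (\<Gamma> 0) \<Gamma>0)"
      using scheme by blast
  qed (use rate in \<open>auto simp: convergence_rate_def\<close>)
qed

end
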